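(* Let $X, d$ be an algebraic Yoneda-complete quasi-metric space, with strong basis $\mathcal B$. The spaces $\mathcal H_0 X, d_{\mathcal H}$ and $\mathcal H X, d_{\mathcal H}$ are algebraic Yoneda-complete. Every closed set of the form $\downarrow \{x_1, \cdots, x_n\}$ where every $x_i$ is a center point (and with $n \geq 1$ in the case of $\mathcal H X$) is a center point of $\mathcal H_0 X, d_{\mathcal H}$ (resp., $\mathcal H X, d_{\mathcal H}$), and those form a strong basis, even when each $x_i$ is taken from $\mathcal B$.
   Context: A quasi-metric on $X$ is a map $d \colon X \times X \to [0,+\infty]$ with $d(x,x)=0$, the triangle inequality, and $d(x,y)=d(y,x)=0 \Rightarrow x=y$. Formal balls are pairs $(x,r)$, $x\in X$, $r\in \mathbb{R}_+=[0,+\infty)$, ordered by $(x,r) \leq^{d^+} (y,s)$ iff $d(x,y) \leq r-s$; they form the poset $\mathbf{B}(X,d)$, with its Scott topology. $X$ is given the $d$-Scott topology, the coarsest one making $x \mapsto (x,0) \in \mathbf{B}(X,d)$ continuous, and is viewed as a subspace of $\mathbf{B}(X,d)$ through that map; $\downarrow$ is downward closure in the specialization ordering ($x \leq y$ iff $d(x,y)=0$). $X,d$ is Yoneda-complete iff $\mathbf{B}(X,d)$ is a dcpo. A point $x$ is a center point iff for every $\epsilon>0$, $\{(y,s) \in \mathbf{B}(X,d) \mid d(x,y) < \epsilon - s\}$ is Scott-open. A strong basis is a set $\mathcal{B}$ of center points such that for every $x \in X$, $(x,0)$ is the supremum in $\mathbf{B}(X,d)$ of a directed family of formal balls with centers in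 $\mathcal{B}$. $X,d$ is algebraic iff it has a strong basis. $\mathcal{H}_0 X$ is the set of closed subsets of $X$, and $\mathcal{H} X$ the set of non-empty closed subsets. For a closed subset $C$ of $X$ let $cl_{\mathbf B}(C)$ be its closure in $\mathbf{B}(X,d)$, and let $d(x,C) = \sup\{r \in \mathbb{R}_+ \mid (x,r) \notin cl_{\mathbf B}(C)\}$ (with $\sup\emptyset=0$). Then $d_{\mathcal H}(C,C') = \sup_{x\in C} d(x,C')$ (equal to $0$ if $C=\emptyset$). *)

theory Defs
  imports "HOL-Algebra.Order" "HOL-Analysis.Analysis"
begin

section \<open>Directed-complete posets and the Scott topology\<close>

definition directed_subset :: "('a, 'c) gorder_scheme \<Rightarrow> 'a set \<Rightarrow> bool" where
  "directed_subset L D \<longleftrightarrow>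
     D \<subseteq> carrier L \<and> D \<noteq> {} \<and>
     (\<forall>x\<in>D. \<forall>y\<in>D. \<exists>z\<in>D. x \<sqsubseteq>\<^bsub>L\<^esub> z \<and> y \<sqsubseteq>\<^bsub>L\<^esub> z)"

definition dcpo :: "('a, 'c) gorder_scheme \<Rightarrow> bool" where
  "dcpo L \<longleftrightarrow>
     partial_order L \<and> (\<forall>D. directed_subset L D \<longrightarrow> (\<exists>s. least L s (Upper L D)))"

definition scott_open :: "('a, 'c) gorder_scheme \<Rightarrow> 'a set \<Rightarrow> bool" where
  "scott_open L U \<longleftrightarrow>
     U \<subseteq> carrier L \<and>
     (\<forall>x\<in>U. \<forall>y\<in>carrier L. x \<sqsubseteq>\<^bsub>L\<^esub> y \<longrightarrow> y \<in> U) \<and>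
     (\<forall>D s. directed_subset L D \<longrightarrow> least L s (Upper L D) \<longrightarrow> s \<in> U \<longrightarrow> D \<inter> U \<noteq> {})"

definition scott_topology :: "('a, 'c) gorder_scheme \<Rightarrow> 'a topology" where
  "scott_topology L = topology (scott_open L)"

lemma istopology_scott_open: "istopology (scott_open L)"
  unfolding istopology_def
proof (intro conjI allI impI)
  fix S T assume S: "scott_open L S" and T: "scott_open L T"
  have "D \<inter> (S \<inter> T) \<noteq> {}"
    if D: "directed_subset L D" and s: "least L s (Upper L D)" "s \<in> S \<inter> T" for D s
  proof -
    have "D \<inter> S \<noteq> {}" "D \<inter> T \<noteq> {}"
      using S T D s unfolding scott_open_def by (metis IntD1, metis IntD2)
    then obtain x y where xy: "x \<in> D" "x \<in> S" "y \<in> D" "y \<in> T" by auto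
    with D obtain z where z: "z \<in> D" "x \<sqsubseteq>\<^bsub>L\<^esub> z" "y \<sqsubseteq>\<^bsub>L\<^esub> z" "z \<in> carrier L"
      unfolding directed_subset_def by (meson subsetD)
    with xy S T have "z \<in> S" "z \<in> T"
      unfolding scott_open_def by (metis, metis)
    with z show ?thesis by auto
  qed
  moreover have "S \<inter> T \<subseteq> carrier L"
    using S unfolding scott_open_def by (meson inf.coboundedI1)
  moreover have "\<forall>x\<in>S \<inter> T. \<forall>y\<in>carrier L. x \<sqsubseteq>\<^bsub>L\<^esub> y \<longrightarrow> y \<in> S \<inter> T"
    using S T unfolding scott_open_def by (metis Int_iff)
  ultimately show "scott_open L (S \<inter> T)"
    unfolding scott_open_def by metis
next
  fix \<K> assume K: "\<forall>K\<in>\<K>. scott_open L K"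
  have "D \<inter> \<Union>\<K> \<noteq> {}"
    if D: "directed_subset L D" "least L s (Upper L D)" and s: "s \<in> \<Union>\<K>" for D s
  proof -
    from s obtain K where "K \<in> \<K>" "s \<in> K" by auto
    with K D have "D \<inter> K \<noteq> {}" unfolding scott_open_def by metis
    with \<open>K \<in> \<K>\<close> show ?thesis by auto
  qed
  moreover have "\<Union>\<K> \<subseteq> carrier L"
    using K unfolding scott_open_def by (meson Union_least)
  moreover have "\<forall>x\<in>\<Union>\<K>. \<forall>y\<in>carrier L. x \<sqsubseteq>\<^bsub>L\<^esub> y \<longrightarrow> y \<in> \<Union>\<K>"
    using K unfolding scott_open_def by (metis Union_iff)
  ultimately show "scott_open L (\<Union>\<K>)"
    unfolding scott_open_def by metis
qed

lemma openin_scott_topology: "openin (scott_topology L) U \<longleftrightarrow> scott_open L U"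
  by (simp add: scott_topology_def topology_inverse' istopology_scott_open)

lemma topspace_scott_topology: "topspace (scott_topology L) = carrier L"
proof -
  have "scott_open L (carrier L)"
    by (auto simp: scott_open_def directed_subset_def)
  then show ?thesis
    by (metis openin_scott_topology openin_subset openin_topspace scott_open_def subset_antisym)
qed


section \<open>Quasi-metric spaces and formal balls\<close>

definition quasi_metric_space :: "'a set \<Rightarrow> ('a \<Rightarrow> 'a \<Rightarrow> ennreal) \<Rightarrow> bool" where
  "quasi_metric_space X d \<longleftrightarrow>
     (\<forall>x\<in>X. d x x = 0) \<and>
     (\<forall>x\<in>X. \<forall>y\<in>X. \<forall>z\<in>X. d x z \<le> d x y + d y z) \<and>
     (\<forall>x\<in>X. \<forall>y\<in>X. d x y = 0 \<longrightarrow> d y x = 0 \<longrightarrow> x = y)"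

text \<open>
  The function \<^const>\<open>ennreal\<close> truncates negative reals to \<open>0\<close>, so the inequality
  \<open>d x y \<le> r - s\<close> needs the explicit side condition \<open>s \<le> r\<close>.
\<close>

definition ball_poset :: "'a set \<Rightarrow> ('a \<Rightarrow> 'a \<Rightarrow> ennreal) \<Rightarrow> ('a \<times> real) gorder" where
  "ball_poset X d =
     \<lparr>carrier = X \<times> {0..}, eq = (=),
      le = (\<lambda>(x, r) (y, s). s \<le> r \<and> d x y \<le> ennreal (r - s))\<rparr>"

abbreviation ball_topology :: "'a set \<Rightarrow> ('a \<Rightarrow> 'a \<Rightarrow> ennreal) \<Rightarrow> ('a \<times> real) topology" where
  "ball_topology X d \<equiv> scott_topology (ball_poset X d)"

definition d_scott_topology :: "'a set \<Rightarrow> ('a \<Rightarrow> 'a \<Rightarrow> ennreal) \<Rightarrow> 'a topology" where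
  "d_scott_topology X d = pullback_topology X (\<lambda>x. (x, 0)) (ball_topology X d)"

definition specialization_down :: "'a set \<Rightarrow> ('a \<Rightarrow> 'a \<Rightarrow> ennreal) \<Rightarrow> 'a set \<Rightarrow> 'a set" where
  "specialization_down X d A = {y \<in> X. \<exists>x\<in>A. d y x = 0}"

definition Yoneda_complete :: "'a set \<Rightarrow> ('a \<Rightarrow> 'a \<Rightarrow> ennreal) \<Rightarrow> bool" where
  "Yoneda_complete X d \<longleftrightarrow> dcpo (ball_poset X d)"

text \<open>
  Below the truncation is harmless: if \<open>\<epsilon> - s\<close> is negative, the strict inequality is false,
  as it should be.
\<close>

definition center_point :: "'a set \<Rightarrow> ('a \<Rightarrow> 'a \<Rightarrow> ennreal) \<Rightarrow> 'a \<Rightarrow> bool" where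
  "center_point X d x \<longleftrightarrow>
     x \<in> X \<and>
     (\<forall>\<epsilon>>0. openin (ball_topology X d)
        {(y, s). (y, s) \<in> carrier (ball_poset X d) \<and> d x y < ennreal (\<epsilon> - s)})"

definition strong_basis :: "'a set \<Rightarrow> ('a \<Rightarrow> 'a \<Rightarrow> ennreal) \<Rightarrow> 'a set \<Rightarrow> bool" where
  "strong_basis X d B \<longleftrightarrow>
     (\<forall>b\<in>B. center_point X d b) \<and>
     (\<forall>x\<in>X. \<exists>D. directed_subset (ball_poset X d) D \<and> fst ` D \<subseteq> B \<and>
        least (ball_poset X d) (x, 0) (Upper (ball_poset X d) D))"

definition algebraic_qms :: "'a set \<Rightarrow> ('a \<Rightarrow> 'a \<Rightarrow> ennreal) \<Rightarrow> bool" where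
  "algebraic_qms X d \<longleftrightarrow> (\<exists>B. strong_basis X d B)"


section \<open>Hyperspaces of closed subsets\<close>

definition closed_hyperspace0 :: "'a set \<Rightarrow> ('a \<Rightarrow> 'a \<Rightarrow> ennreal) \<Rightarrow> 'a set set" where
  "closed_hyperspace0 X d = {C. closedin (d_scott_topology X d) C}"

definition closed_hyperspace :: "'a set \<Rightarrow> ('a \<Rightarrow> 'a \<Rightarrow> ennreal) \<Rightarrow> 'a set set" where
  "closed_hyperspace X d = {C \<in> closed_hyperspace0 X d. C \<noteq> {}}"

definition ball_closure :: "'a set \<Rightarrow> ('a \<Rightarrow> 'a \<Rightarrow> ennreal) \<Rightarrow> 'a set \<Rightarrow> ('a \<times> real) set" where
  "ball_closure X d C = ball_topology X d closure_of ((\<lambda>x. (x, 0)) ` C)"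

text \<open>In \<^typ>\<open>ennreal\<close> the supremum of the empty set is \<open>0\<close>.\<close>

definition point_closed_dist ::
    "'a set \<Rightarrow> ('a \<Rightarrow> 'a \<Rightarrow> ennreal) \<Rightarrow> 'a \<Rightarrow> 'a set \<Rightarrow> ennreal" where
  "point_closed_dist X d x C = Sup {ennreal r | r. 0 \<le> r \<and> (x, r) \<notin> ball_closure X d C}"

definition hausdorff_quasi_metric ::
    "'a set \<Rightarrow> ('a \<Rightarrow> 'a \<Rightarrow> ennreal) \<Rightarrow> 'a set \<Rightarrow> 'a set \<Rightarrow> ennreal" where
  "hausdorff_quasi_metric X d C C' = (SUP x\<in>C. point_closed_dist X d x C')"

end

theory Submission
  imports Defs
begin

text \<open>
  For a closed set \<open>C\<close> and a center point \<open>a\<close>, \<open>d(a, C)\<close> is the infimum of \<open>d(a, y)\<close> over \<open>y \<in> C\<close>.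
  A closed set is determined by the function \<open>b \<mapsto> d(b, C)\<close> on a strong basis \<open>B\<close>, and
  \<open>d\<^sub>H(C, C') \<le> t\<close> means \<open>d(b, C') \<le> d(b, C) + t\<close> for every \<open>b \<in> B\<close>. The supremum of a directed
  family of balls \<open>(C\<^sub>i, r\<^sub>i)\<close> has radius \<open>r = inf r\<^sub>i\<close>, and its center is the closed set
  with \<open>d(b, C) = inf (d(b, C\<^sub>i) + r\<^sub>i - r)\<close>; that such a set exists is where
  Yoneda-completeness of \<open>X\<close> enters. Since \<open>d\<^sub>H(\<down>F, C)\<close> is the maximum of \<open>d(a, C)\<close> over \<open>a \<in> F\<close>
  when \<open>F\<close> is a finite set of center points, that formula for suprema makes \<open>\<down>F\<close> a center point. Finally
  \<open>(C, 0)\<close> is the supremum of the balls \<open>(\<down>F, r)\<close> with \<open>F\<close> a finite subset of \<open>B\<close>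
  such that \<open>d(b, C) < r\<close> for every \<open>b \<in> F\<close>.
\<close>

section \<open>Arithmetic of extended non-negative reals with real radii\<close>

text \<open>Lets the ball order be written as \<open>d x y + s \<le> r\<close>. In this additive
  form the side condition \<open>s \<le> r\<close> is implied, and no truncated subtraction
  occurs.\<close>

lemma ennreal_add_le_iff:
  fixes a :: ennreal
  assumes "0 \<le> r" "0 \<le> s"
  shows "a + ennreal s \<le> ennreal r \<longleftrightarrow> s \<le> r \<and> a \<le> ennreal (r - s)"
proof (cases a rule: ennreal_cases)
  case (real x)
  then show ?thesis
    using assms by (auto simp flip: ennreal_plus simp: ennreal_le_iff2)
next
  case top
  then show ?thesis by (simp add: top_unique)
qed

lemma ennreal_less_diff_iff:
  fixes a :: ennreal
  assumes "0 \<le> s"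
  shows "a < ennreal (e - s) \<longleftrightarrow> a + ennreal s < ennreal e"
proof (cases a rule: ennreal_cases)
  case (real x)
  then show ?thesis
    using assms by (auto simp flip: ennreal_plus simp: ennreal_less_iff)
next
  case top
  then show ?thesis by simp
qed

text \<open>An extended real is determined by its real upper bounds, infinity being the value that
  has none. This suits distances known only through statements of the form "at most
  \<open>t\<close>".\<close>

lemma ennreal_eqI_reals:
  fixes a b :: ennreal
  assumes "\<And>t. 0 \<le> t \<Longrightarrow> a \<le> ennreal t \<longleftrightarrow> b \<le> ennreal t"
  shows "a = b"
proof -
  have "x \<le> y" if "\<And>t. 0 \<le> t \<Longrightarrow> y \<le> ennreal t \<Longrightarrow> x \<le> ennreal t" for x y :: ennreal
    using that by (cases y rule: ennreal_cases) auto
  with assms show ?thesis by (meson antisym)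
qed

lemma ennreal_real_between:
  fixes a b :: ennreal
  assumes "a < b"
  obtains t where "0 < t" "a < ennreal t" "ennreal t < b"
proof -
  obtain c where c: "a < c" "c < b" using dense assms by blast
  then have "c < \<infinity>" by (metis infinity_ennreal_def order_less_le_trans top_greatest)
  then obtain t where t: "c = ennreal t" "0 \<le> t" by (cases c rule: ennreal_cases) auto
  with c have "0 < t" by (cases "t = 0") auto
  with that c t show ?thesis by blast
qed

text \<open>Subtracting a finite constant is left adjoint to adding it, so addition commutes with
  infima. The empty family is covered: both sides are then infinite.\<close>

lemma INF_add_ennreal_const:
  fixes f :: "'i \<Rightarrow> ennreal"
  shows "(INF i\<in>I. f i + ennreal c) = (INF i\<in>I. f i) + ennreal c"
proof (rule antisym)
  let ?L = "INF i\<in>I. f i + ennreal c"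
  have "?L - ennreal c \<le> (INF i\<in>I. f i)"
    by (intro INF_greatest) (auto simp: ennreal_minus_le_iff add.commute intro: INF_lower)
  then show "?L \<le> (INF i\<in>I. f i) + ennreal c"
    by (auto simp: ennreal_minus_le_iff add.commute)
qed (auto intro!: INF_greatest add_right_mono INF_lower)

text \<open>A finite supremum preserves strict bounds. The hypothesis \<open>0 < y\<close> takes
  care of the empty family, whose supremum is 0.\<close>

lemma finite_SUP_less_iff:
  fixes g :: "'i \<Rightarrow> ennreal"
  assumes "finite F" "0 < y"
  shows "(SUP i\<in>F. g i) < y \<longleftrightarrow> (\<forall>i\<in>F. g i < y)"
  using assms(1) by (induction F) (use assms(2) in \<open>auto simp: bot_ennreal sup_max\<close>)

lemma ennreal_add_le_shift:
  fixes a :: ennreal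
  assumes "0 \<le> r" "0 \<le> s" "0 \<le> r + t" "0 \<le> s + t"
  shows "a + ennreal (s + t) \<le> ennreal (r + t) \<longleftrightarrow> a + ennreal s \<le> ennreal r"
  using assms by (simp add: ennreal_add_le_iff)

lemma ennreal_add_const_le_iff:
  fixes a b :: ennreal
  shows "a + ennreal c \<le> b + ennreal c \<longleftrightarrow> a \<le> b"
  by (metis add.commute ennreal_add_left_cancel_le ennreal_neq_top infinity_ennreal_def)

lemma ennreal_add_shift:
  fixes a :: ennreal
  assumes "0 \<le> s" "s \<le> r"
  shows "a + ennreal (r - s) + ennreal s = a + ennreal r"
  using assms by (simp add: add.assoc flip: ennreal_plus)

section \<open>The poset of formal balls\<close>

lemma carrier_ball_poset [simp]: "carrier (ball_poset X d) = X \<times> {0..}"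
  by (simp add: ball_poset_def)

lemma le_ball_poset:
  "0 \<le> r \<Longrightarrow> 0 \<le> s \<Longrightarrow> (x, r) \<sqsubseteq>\<^bsub>ball_poset X d\<^esub> (y, s) \<longleftrightarrow> d x y + ennreal s \<le> ennreal r"
  by (simp add: ball_poset_def ennreal_add_le_iff)

lemma ball_le_trans:
  assumes "quasi_metric_space X d" "x \<in> X" "y \<in> X" "z \<in> X"
    and "d x y + ennreal s \<le> ennreal r" "d y z + ennreal t \<le> ennreal s"
  shows "d x z + ennreal t \<le> ennreal r"
proof -
  have "d x z \<le> d x y + d y z"
    using assms unfolding quasi_metric_space_def by blast
  then have "d x z + ennreal t \<le> d x y + (d y z + ennreal t)"
    by (metis add.assoc add_right_mono)
  also have "\<dots> \<le> d x y + ennreal s" using assms by (intro add_left_mono)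
  finally show ?thesis using assms by (meson order_trans)
qed

lemma partial_order_ball_poset:
  assumes qm: "quasi_metric_space X d"
  shows "partial_order (ball_poset X d)"
proof
  show "p \<sqsubseteq>\<^bsub>ball_poset X d\<^esub> p" if "p \<in> carrier (ball_poset X d)" for p
    using qm that unfolding quasi_metric_space_def by (cases p) (auto simp: le_ball_poset)
next
  fix p q
  assume "p \<sqsubseteq>\<^bsub>ball_poset X d\<^esub> q" "q \<sqsubseteq>\<^bsub>ball_poset X d\<^esub> p"
    and pq: "p \<in> carrier (ball_poset X d)" "q \<in> carrier (ball_poset X d)"
  moreover obtain x r y s where "p = (x, r)" "q = (y, s)" by (cases p, cases q)
  ultimately have "s = r" "d x y = 0" "d y x = 0" "x \<in> X" "y \<in> X"
    by (auto simp: ball_poset_def)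
  then have "p = q"
    using qm \<open>p = (x, r)\<close> \<open>q = (y, s)\<close> unfolding quasi_metric_space_def by blast
  then show "p .=\<^bsub>ball_poset X d\<^esub> q" by (simp add: ball_poset_def)
next
  fix p q w
  assume "p \<sqsubseteq>\<^bsub>ball_poset X d\<^esub> q" "q \<sqsubseteq>\<^bsub>ball_poset X d\<^esub> w"
    and "p \<in> carrier (ball_poset X d)" "q \<in> carrier (ball_poset X d)"
      "w \<in> carrier (ball_poset X d)"
  then show "p \<sqsubseteq>\<^bsub>ball_poset X d\<^esub> w"
    by (cases p; cases q; cases w) (auto simp: le_ball_poset intro: ball_le_trans[OF qm])
qed (auto simp: ball_poset_def)

lemma directed_ball_iff:
  "directed_subset (ball_poset X d) D \<longleftrightarrow>
     D \<subseteq> X \<times> {0..} \<and> D \<noteq> {} \<and>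
     (\<forall>x r y s. (x, r) \<in> D \<longrightarrow> (y, s) \<in> D \<longrightarrow>
        (\<exists>z t. (z, t) \<in> D \<and> d x z + ennreal t \<le> ennreal r \<and> d y z + ennreal t \<le> ennreal s))"
  (is "?L \<longleftrightarrow> ?R")
proof -
  have "(\<forall>p\<in>D. \<forall>q\<in>D. \<exists>w\<in>D. p \<sqsubseteq>\<^bsub>ball_poset X d\<^esub> w \<and> q \<sqsubseteq>\<^bsub>ball_poset X d\<^esub> w) \<longleftrightarrow>
     (\<forall>x r y s. (x, r) \<in> D \<longrightarrow> (y, s) \<in> D \<longrightarrow>
        (\<exists>z t. (z, t) \<in> D \<and> d x z + ennreal t \<le> ennreal r \<and> d y z + ennreal t \<le> ennreal s))"
    if D: "D \<subseteq> X \<times> {0..}"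
  proof -
    have nn: "0 \<le> r" if "(x, r) \<in> D" for x r using D that by auto
    show ?thesis
      by (simp add: split_paired_Ball_Sigma split_paired_Bex_Sigma Ball_def Bex_def)
        (metis le_ball_poset nn)
  qed
  then show ?thesis unfolding directed_subset_def by auto
qed

section \<open>Suprema of families of formal balls\<close>

text \<open>The supremum in the poset of formal balls, spelled out in the additive form of the
  order; \<open>least_ball_iff\<close> gives the agreement with \<open>least\<close> and
  \<open>Upper\<close>.\<close>

definition ball_lub :: "'a set \<Rightarrow> ('a \<Rightarrow> 'a \<Rightarrow> ennreal) \<Rightarrow> ('a \<times> real) set \<Rightarrow> 'a \<Rightarrow> real \<Rightarrow> bool"
  where "ball_lub X d D x r \<longleftrightarrow> x \<in> X \<and> 0 \<le> r \<and>
     (\<forall>y s. (y, s) \<in> D \<longrightarrow> d y x + ennreal r \<le> ennreal s) \<and>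
     (\<forall>z\<in>X. \<forall>t\<ge>0. (\<forall>y s. (y, s) \<in> D \<longrightarrow> d y z + ennreal t \<le> ennreal s) \<longrightarrow>
        d x z + ennreal t \<le> ennreal r)"

lemma least_ball_iff:
  assumes D: "D \<subseteq> X \<times> {0..}"
  shows "least (ball_poset X d) (x, r) (Upper (ball_poset X d) D) \<longleftrightarrow> ball_lub X d D x r"
proof -
  have U: "(z, t) \<in> Upper (ball_poset X d) D \<longleftrightarrow>
      z \<in> X \<and> 0 \<le> t \<and> (\<forall>y s. (y, s) \<in> D \<longrightarrow> d y z + ennreal t \<le> ennreal s)" for z t
  proof -
    have nn: "y \<in> X \<and> 0 \<le> s" if "(y, s) \<in> D" for y s using D that by auto
    then show ?thesis unfolding Upper_def by (auto simp: le_ball_poset)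
  qed
  have "Upper (ball_poset X d) D \<subseteq> carrier (ball_poset X d)"
    by (auto simp: Upper_def)
  then have "least (ball_poset X d) (x, r) (Upper (ball_poset X d) D) \<longleftrightarrow>
      (x, r) \<in> Upper (ball_poset X d) D \<and>
      (\<forall>z t. (z, t) \<in> Upper (ball_poset X d) D \<longrightarrow> (x, r) \<sqsubseteq>\<^bsub>ball_poset X d\<^esub> (z, t))"
    unfolding least_def by auto
  then show ?thesis unfolding U ball_lub_def by (auto simp: le_ball_poset)
qed

lemma ball_lub_unique:
  assumes "quasi_metric_space X d" "D \<subseteq> X \<times> {0..}" "ball_lub X d D x r" "ball_lub X d D y s"
  shows "x = y" "r = s"
  using partial_order.least_unique[OF partial_order_ball_poset[OF assms(1)]] assms
  unfolding least_ball_iff[OF assms(2), symmetric] by blast+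

lemma dcpo_ball_iff:
  assumes "quasi_metric_space X d"
  shows "dcpo (ball_poset X d) \<longleftrightarrow>
    (\<forall>D. directed_subset (ball_poset X d) D \<longrightarrow> (\<exists>x r. ball_lub X d D x r))"
  unfolding dcpo_def using partial_order_ball_poset[OF assms]
  by (auto simp: least_ball_iff directed_ball_iff)

lemma scott_open_ball_iff:
  "scott_open (ball_poset X d) U \<longleftrightarrow> U \<subseteq> X \<times> {0..} \<and>
    (\<forall>x r y s. (x, r) \<in> U \<longrightarrow> y \<in> X \<longrightarrow> 0 \<le> s \<longrightarrow> d x y + ennreal s \<le> ennreal r \<longrightarrow> (y, s) \<in> U) \<and>
    (\<forall>D x r. directed_subset (ball_poset X d) D \<longrightarrow> ball_lub X d D x r \<longrightarrow> (x, r) \<in> U \<longrightarrow>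
       D \<inter> U \<noteq> {})"
proof -
  have "(\<forall>p\<in>U. \<forall>q\<in>X \<times> {0..}. p \<sqsubseteq>\<^bsub>ball_poset X d\<^esub> q \<longrightarrow> q \<in> U) \<longleftrightarrow>
    (\<forall>x r y s. (x, r) \<in> U \<longrightarrow> y \<in> X \<longrightarrow> 0 \<le> s \<longrightarrow> d x y + ennreal s \<le> ennreal r \<longrightarrow> (y, s) \<in> U)"
    if U: "U \<subseteq> X \<times> {0..}"
  proof -
    have nn: "0 \<le> r" if "(x, r) \<in> U" for x r using U that by auto
    show ?thesis
      by (simp add: split_paired_Ball_Sigma Ball_def) (metis le_ball_poset nn)
  qed
  moreover have "(\<forall>D p. directed_subset (ball_poset X d) D \<longrightarrow>
      least (ball_poset X d) p (Upper (ball_poset X d) D) \<longrightarrow> p \<in> U \<longrightarrow> D \<inter> U \<noteq> {}) \<longleftrightarrow>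
    (\<forall>D x r. directed_subset (ball_poset X d) D \<longrightarrow> ball_lub X d D x r \<longrightarrow> (x, r) \<in> U \<longrightarrow>
       D \<inter> U \<noteq> {})"
    by (simp add: directed_ball_iff least_ball_iff)
  ultimately show ?thesis unfolding scott_open_def carrier_ball_poset by auto
qed

lemma center_point_iff:
  "center_point X d a \<longleftrightarrow> a \<in> X \<and> (\<forall>e>0. scott_open (ball_poset X d)
     {(y, s). y \<in> X \<and> 0 \<le> s \<and> d a y + ennreal s < ennreal e})"
proof -
  have "{(y, s). (y, s) \<in> carrier (ball_poset X d) \<and> d a y < ennreal (e - s)} =
     {(y, s). y \<in> X \<and> 0 \<le> s \<and> d a y + ennreal s < ennreal e}" for e
    by (auto simp: ennreal_less_diff_iff)
  then show ?thesis unfolding center_point_def openin_scott_topology by simp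
qed

text \<open>The balls \<open>(y, s)\<close> with \<open>d a y + s < e\<close> form a Scott-open set
  because \<open>a\<close> is a center point, so a directed family whose supremum lies in it already
  meets it.\<close>

lemma center_point_ball_lub:
  assumes a: "center_point X d a" and D: "directed_subset (ball_poset X d) D"
    and lub: "ball_lub X d D x r" and less: "d a x + ennreal r < ennreal e"
  obtains y s where "(y, s) \<in> D" "d a y + ennreal s < ennreal e"
proof -
  let ?U = "{(y, s). y \<in> X \<and> 0 \<le> s \<and> d a y + ennreal s < ennreal e}"
  have "0 < e" using less by (metis ennreal_eq_0_iff not_le not_less_zero)
  then have "scott_open (ball_poset X d) ?U" using a unfolding center_point_iff by blast
  moreover have "(x, r) \<in> ?U" using lub less unfolding ball_lub_def by auto
  ultimately have "D \<inter> ?U \<noteq> {}" using D lub unfolding scott_open_ball_iff by blast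
  with that show ?thesis by auto
qed

lemma ball_lub_upper:
  "ball_lub X d D x r \<Longrightarrow> (y, s) \<in> D \<Longrightarrow> d y x + ennreal r \<le> ennreal s"
  unfolding ball_lub_def by meson

lemma ball_lub_least:
  assumes "ball_lub X d D x r" "z \<in> X" "0 \<le> t"
    "\<And>y s. (y, s) \<in> D \<Longrightarrow> d y z + ennreal t \<le> ennreal s"
  shows "d x z + ennreal t \<le> ennreal r"
  using assms unfolding ball_lub_def by meson

section \<open>Yoneda-complete spaces\<close>

locale yoneda_qms =
  fixes X :: "'a set" and d :: "'a \<Rightarrow> 'a \<Rightarrow> ennreal"
  assumes qm: "quasi_metric_space X d" and yc: "Yoneda_complete X d"
begin

lemma refl [simp]: "x \<in> X \<Longrightarrow> d x x = 0"
  using qm unfolding quasi_metric_space_def by blast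

lemma triangle: "x \<in> X \<Longrightarrow> y \<in> X \<Longrightarrow> z \<in> X \<Longrightarrow> d x z \<le> d x y + d y z"
  using qm unfolding quasi_metric_space_def by blast

lemma antisym: "x \<in> X \<Longrightarrow> y \<in> X \<Longrightarrow> d x y = 0 \<Longrightarrow> d y x = 0 \<Longrightarrow> x = y"
  using qm unfolding quasi_metric_space_def by blast

lemma directed_has_lub:
  assumes "directed_subset (ball_poset X d) D"
  obtains x r where "ball_lub X d D x r"
  using assms yc qm unfolding Yoneda_complete_def by (auto simp: dcpo_ball_iff)

text \<open>The ball order sees only differences of radii, so a common shift preserves it. The shift
  may be negative as long as the radii stay non-negative.\<close>

lemma directed_shift:
  assumes D: "directed_subset (ball_poset X d) D" and t: "\<And>y s. (y, s) \<in> D \<Longrightarrow> 0 \<le> s + t"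
  shows "directed_subset (ball_poset X d) ((\<lambda>(y, s). (y, s + t)) ` D)" (is "directed_subset _ ?D")
  unfolding directed_ball_iff
proof (intro conjI allI impI)
  show "?D \<subseteq> X \<times> {0..}" "?D \<noteq> {}" using D t unfolding directed_ball_iff by auto
  fix x r y s assume "(x, r) \<in> ?D" "(y, s) \<in> ?D"
  then have "(x, r - t) \<in> D" "(y, s - t) \<in> D" by auto
  then obtain z u where z: "(z, u) \<in> D" "d x z + ennreal u \<le> ennreal (r - t)"
      "d y z + ennreal u \<le> ennreal (s - t)"
    using D unfolding directed_ball_iff by blast
  have "0 \<le> u" "0 \<le> r - t" "0 \<le> s - t"
    using D z \<open>(x, r - t) \<in> D\<close> \<open>(y, s - t) \<in> D\<close> unfolding directed_ball_iff by auto
  moreover have "0 \<le> r" "0 \<le> s" "0 \<le> u + t"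
    using t[OF \<open>(x, r - t) \<in> D\<close>] t[OF \<open>(y, s - t) \<in> D\<close>] t[OF z(1)] by auto
  ultimately have "d x z + ennreal (u + t) \<le> ennreal r" "d y z + ennreal (u + t) \<le> ennreal s"
    using z ennreal_add_le_shift[of "r - t" u t] ennreal_add_le_shift[of "s - t" u t] by auto
  moreover have "(z, u + t) \<in> ?D" using z by force
  ultimately show "\<exists>z t. (z, t) \<in> ?D \<and> d x z + ennreal t \<le> ennreal r \<and> d y z + ennreal t \<le> ennreal s"
    by blast
qed

text \<open>If all radii were at least \<open>e\<close>, lowering them by \<open>e\<close> would
  give a directed family with some supremum \<open>(z, r)\<close>. Then \<open>(z, r + e)\<close>
  bounds \<open>D\<close>, hence lies above \<open>(x, 0)\<close>, although its radius is
  positive.\<close>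

lemma lub_small_radius:
  assumes D: "directed_subset (ball_poset X d) D" and lub: "ball_lub X d D x 0" and e: "0 < e"
  obtains y s where "(y, s) \<in> D" "s < e"
proof (rule ccontr)
  assume "\<not> thesis"
  with that have le: "\<And>y s. (y, s) \<in> D \<Longrightarrow> e \<le> s" by force
  let ?D = "(\<lambda>(y, s). (y, s + - e)) ` D"
  have "directed_subset (ball_poset X d) ?D"
    by (rule directed_shift[OF D]) (use le in force)
  then obtain z r where z: "ball_lub X d ?D z r" by (rule directed_has_lub)
  have "d y z + ennreal (r + e) \<le> ennreal s" if "(y, s) \<in> D" for y s
  proof -
    have "d y z + ennreal r \<le> ennreal (s - e)"
      using z that unfolding ball_lub_def by force
    then show ?thesis
      using z e le[OF that] ennreal_add_le_shift[of "s - e" r e] unfolding ball_lub_def by auto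
  qed
  moreover have "z \<in> X" "0 \<le> r + e" using z e unfolding ball_lub_def by auto
  ultimately have "d x z + ennreal (r + e) \<le> ennreal 0"
    by (rule ball_lub_least[OF lub, rotated 2])
  then show False using z e unfolding ball_lub_def by auto
qed

text \<open>Yoneda-complete spaces are standard.\<close>

lemma lub_shift:
  assumes D: "directed_subset (ball_poset X d) D" and lub: "ball_lub X d D x 0" and t: "0 \<le> t"
  shows "ball_lub X d ((\<lambda>(y, s). (y, s + t)) ` D) x t" (is "ball_lub _ _ ?D _ _")
proof -
  have nn: "y \<in> X \<and> 0 \<le> s" if "(y, s) \<in> D" for y s
    using D that unfolding directed_ball_iff by auto
  have x: "x \<in> X" using lub unfolding ball_lub_def by blast
  have "directed_subset (ball_poset X d) ?D"
    by (rule directed_shift[OF D]) (use nn t in force)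
  \<comment> \<open>Completeness supplies some supremum \<open>(z, r)\<close>. It lies below
    \<open>(x, t)\<close>, which gives \<open>t \<le> r\<close>; undoing the shift then shows that
    \<open>(z, r - t)\<close> lies above \<open>(x, 0)\<close>, so that \<open>r = t\<close> and
    \<open>z = x\<close>.\<close>
  then obtain z r where z: "ball_lub X d ?D z r" by (rule directed_has_lub)
  have "d y x + ennreal t \<le> ennreal s" if "(y, s) \<in> ?D" for y s
  proof -
    have "(y, s - t) \<in> D" using that by auto
    moreover have "d y x + ennreal 0 \<le> ennreal (s - t)"
      using lub calculation unfolding ball_lub_def by blast
    ultimately show ?thesis using t nn[of y "s - t"] by (auto simp: ennreal_add_le_iff)
  qed
  then have zx: "d z x + ennreal t \<le> ennreal r" using z x t unfolding ball_lub_def by blast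
  have zX: "z \<in> X" "0 \<le> r" using z unfolding ball_lub_def by auto
  with zx t have tr: "t \<le> r" by (auto simp: ennreal_add_le_iff)
  have "d y z + ennreal (r - t) \<le> ennreal s" if "(y, s) \<in> D" for y s
  proof -
    have "d y z + ennreal r \<le> ennreal (s + t)"
      using z that unfolding ball_lub_def by force
    then show ?thesis using tr t nn[OF that] ennreal_add_le_shift[of s "r - t" t] by auto
  qed
  moreover have "0 \<le> r - t" using tr by simp
  ultimately have "d x z + ennreal (r - t) \<le> ennreal 0"
    using ball_lub_least[OF lub zX(1)] by blast
  then have rt: "r = t" and "d x z = 0" using tr by auto
  moreover have "d z x = 0" using zx t rt by (auto simp: ennreal_add_le_iff)
  ultimately show ?thesis using z antisym x zX by auto
qed

section \<open>Closed sets of formal balls and distance to a closed set\<close>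

lemma closedin_down:
  assumes "closedin (ball_topology X d) Z" "(y, s) \<in> Z" "x \<in> X" "0 \<le> r"
    "d x y + ennreal s \<le> ennreal r"
  shows "(x, r) \<in> Z"
proof (rule ccontr)
  assume "(x, r) \<notin> Z"
  then have "(x, r) \<in> X \<times> {0..} - Z" using assms by auto
  moreover have "scott_open (ball_poset X d) (X \<times> {0..} - Z)" and "Z \<subseteq> X \<times> {0..}"
    using assms(1) by (auto simp: closedin_def topspace_scott_topology openin_scott_topology)
  ultimately have "(y, s) \<in> X \<times> {0..} - Z"
    unfolding scott_open_ball_iff using assms by blast
  then show False using assms by blast
qed

lemma closedin_lub:
  assumes "closedin (ball_topology X d) Z" "directed_subset (ball_poset X d) D" "D \<subseteq> Z"
    "ball_lub X d D x r"
  shows "(x, r) \<in> Z"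
proof (rule ccontr)
  assume "(x, r) \<notin> Z"
  moreover have "scott_open (ball_poset X d) (X \<times> {0..} - Z)" and "Z \<subseteq> X \<times> {0..}"
    using assms(1) by (auto simp: closedin_def topspace_scott_topology openin_scott_topology)
  moreover have "(x, r) \<in> X \<times> {0..}" using assms unfolding ball_lub_def by auto
  ultimately have "D \<inter> (X \<times> {0..} - Z) \<noteq> {}"
    unfolding scott_open_ball_iff using assms by blast
  with assms show False by auto
qed

text \<open>\<open>(x, r)\<close> is the supremum of the balls \<open>(x, r + e)\<close> with
  \<open>e > 0\<close>, so membership in a closed set may be proved with arbitrarily small slack in
  the radius.\<close>

lemma closedin_radius_limit:
  assumes Z: "closedin (ball_topology X d) Z" and x: "x \<in> X" "0 \<le> r"
    and lim: "\<And>e. 0 < e \<Longrightarrow> (x, r + e) \<in> Z"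
  shows "(x, r) \<in> Z"
proof (rule closedin_lub[OF Z])
  let ?D = "(\<lambda>e. (x, r + e)) ` {0<..}"
  show "directed_subset (ball_poset X d) ?D" unfolding directed_ball_iff
  proof (intro conjI allI impI)
    fix y s z t assume "(y, s) \<in> ?D" "(z, t) \<in> ?D"
    moreover have "(x, min s t) \<in> ?D" using calculation by (cases "s \<le> t") (auto simp: min_def)
    moreover have "d y x + ennreal (min s t) \<le> ennreal s \<and> d z x + ennreal (min s t) \<le> ennreal t"
      using calculation x by auto
    ultimately show "\<exists>w u. (w, u) \<in> ?D \<and> d y w + ennreal u \<le> ennreal s \<and> d z w + ennreal u \<le> ennreal t"
      by blast
  qed (use x in \<open>auto intro: exI[of _ 1]\<close>)
  show "?D \<subseteq> Z" using lim by auto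
  show "ball_lub X d ?D x r" unfolding ball_lub_def
  proof (intro conjI allI ballI impI)
    fix z t assume ub: "\<forall>y s. (y, s) \<in> ?D \<longrightarrow> d y z + ennreal t \<le> ennreal s"
    show "d x z + ennreal t \<le> ennreal r"
    proof (rule ennreal_le_epsilon)
      fix e :: real assume "0 < e"
      then show "d x z + ennreal t \<le> ennreal r + ennreal e"
        using ub x by (simp flip: ennreal_plus)
    qed
  qed (use x in auto)
qed

lemma closedin_ball_closure: "closedin (ball_topology X d) (ball_closure X d C)"
  unfolding ball_closure_def by simp

lemma ball_closure_base:
  assumes "C \<subseteq> X" "x \<in> C"
  shows "(x, 0) \<in> ball_closure X d C"
proof -
  have "(\<lambda>x. (x, 0)) ` C \<subseteq> topspace (ball_topology X d)"
    using assms by (auto simp: topspace_scott_topology)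
  then show ?thesis
    using assms closure_of_subset unfolding ball_closure_def by fastforce
qed

text \<open>The radii \<open>r\<close> with \<open>(x, r)\<close> in the closure form an up-set by
  \<open>closedin_down\<close>, and it is stable under limits from above by
  \<open>closedin_radius_limit\<close>. So the supremum of the radii outside is itself inside
  whenever it is finite.\<close>

lemma point_closed_dist_le_iff:
  assumes x: "x \<in> X" "0 \<le> t"
  shows "point_closed_dist X d x C \<le> ennreal t \<longleftrightarrow> (x, t) \<in> ball_closure X d C"
proof
  assume le: "point_closed_dist X d x C \<le> ennreal t"
  show "(x, t) \<in> ball_closure X d C"
  proof (rule closedin_radius_limit[OF closedin_ball_closure x], rule ccontr)
    fix e :: real assume e: "0 < e" and "(x, t + e) \<notin> ball_closure X d C"
    then have "ennreal (t + e) \<le> point_closed_dist X d x C"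
      unfolding point_closed_dist_def using x by (intro Sup_upper CollectI exI[of _ "t + e"]) (simp del: ennreal_plus)
    with le have "ennreal (t + e) \<le> ennreal t" by (rule order_trans[rotated])
    with e x show False by simp
  qed
next
  assume t: "(x, t) \<in> ball_closure X d C"
  have "r \<le> t" if "0 \<le> r" "(x, r) \<notin> ball_closure X d C" for r
  proof (rule ccontr)
    assume "\<not> r \<le> t"
    then have "d x x + ennreal t \<le> ennreal r" using x by simp
    with closedin_down[OF closedin_ball_closure t] that x show False by blast
  qed
  then show "point_closed_dist X d x C \<le> ennreal t"
    unfolding point_closed_dist_def using x by (auto intro!: Sup_least ennreal_leI)
qed

lemma hausdorff_le_iff:
  assumes "C \<subseteq> X" "0 \<le> t"
  shows "hausdorff_quasi_metric X d C C' \<le> ennreal t \<longleftrightarrow> (\<forall>x\<in>C. (x, t) \<in> ball_closure X d C')"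
  unfolding hausdorff_quasi_metric_def SUP_le_iff
  using assms by (auto simp: subset_iff point_closed_dist_le_iff)

text \<open>Agrees with \<^const>\<open>point_closed_dist\<close> when \<open>a\<close> is a center point, but not in general.\<close>

definition center_dist :: "'a \<Rightarrow> 'a set \<Rightarrow> ennreal" where
  "center_dist a C = (INF y\<in>C. d a y)"

lemma center_dist_lessE:
  assumes "center_dist a C < t"
  obtains y where "y \<in> C" "d a y < t"
  using assms that unfolding center_dist_def INF_less_iff by metis

lemma center_dist_lower: "y \<in> C \<Longrightarrow> center_dist a C \<le> d a y"
  unfolding center_dist_def by (rule INF_lower)

lemma center_dist_Lipschitz:
  assumes "a \<in> X" "b \<in> X" "C \<subseteq> X"
  shows "center_dist a C \<le> d a b + center_dist b C"
proof (cases "d a b")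
  case (real t)
  have "center_dist a C \<le> (INF y\<in>C. d b y + ennreal t)"
  proof (rule INF_greatest)
    fix y assume y: "y \<in> C"
    then have "d a y \<le> d a b + d b y" using assms by (intro triangle) auto
    then show "center_dist a C \<le> d b y + ennreal t"
      using center_dist_lower[OF y, of a] real by (metis add.commute order_trans)
  qed
  then show ?thesis unfolding INF_add_ennreal_const real center_dist_def by (simp add: add.commute)
qed simp

text \<open>From left to right, the open set of balls around the center point \<open>a\<close> with
  bound \<open>r + e\<close> contains \<open>(a, r)\<close> and hence meets the embedded copy of
  \<open>C\<close>. Conversely, a point \<open>y\<close> of \<open>C\<close> with
  \<open>d a y < r + e\<close> puts \<open>(a, r + e)\<close> below \<open>(y, 0)\<close>, and
  \<open>e\<close> tends to 0.\<close>

lemma center_ball_closure_iff: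
  assumes a: "center_point X d a" and C: "C \<subseteq> X" and r: "0 \<le> r"
  shows "(a, r) \<in> ball_closure X d C \<longleftrightarrow> center_dist a C \<le> ennreal r"
proof
  assume ar: "(a, r) \<in> ball_closure X d C"
  have aX: "a \<in> X" using a unfolding center_point_iff by blast
  show "center_dist a C \<le> ennreal r"
  proof (rule ennreal_le_epsilon)
    fix e :: real assume e: "0 < e"
    let ?U = "{(y, s). y \<in> X \<and> 0 \<le> s \<and> d a y + ennreal s < ennreal (r + e)}"
    have "openin (ball_topology X d) ?U"
      using a add_nonneg_pos[OF r e] unfolding center_point_iff openin_scott_topology by meson
    moreover have "(a, r) \<in> ?U" using aX r e by (auto simp: ennreal_less_iff)
    ultimately have "\<exists>p. p \<in> (\<lambda>x. (x, 0)) ` C \<and> p \<in> ?U"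
      using ar unfolding ball_closure_def in_closure_of by meson
    then obtain y where "y \<in> C" "d a y < ennreal (r + e)" by auto
    then have "center_dist a C \<le> ennreal (r + e)"
      by (meson center_dist_lower less_imp_le order_trans)
    then show "center_dist a C \<le> ennreal r + ennreal e"
      using r e by simp
  qed
next
  assume le: "center_dist a C \<le> ennreal r"
  have aX: "a \<in> X" using a unfolding center_point_iff by blast
  show "(a, r) \<in> ball_closure X d C"
  proof (rule closedin_radius_limit[OF closedin_ball_closure aX r])
    fix e :: real assume e: "0 < e"
    have "center_dist a C < ennreal (r + e)"
      using r e by (intro order_le_less_trans[OF le]) (simp add: ennreal_less_iff del: ennreal_plus)
    then obtain y where y: "y \<in> C" "d a y < ennreal (r + e)" by (rule center_dist_lessE)
    then have "d a y + ennreal 0 \<le> ennreal (r + e)" by (metis add.right_neutral ennreal_0 less_imp_le)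
    moreover have "0 \<le> r + e" using r e by simp
    ultimately show "(a, r + e) \<in> ball_closure X d C"
      by (intro closedin_down[OF closedin_ball_closure ball_closure_base[OF C y(1)] aX])
  qed
qed

section \<open>Closed subsets of the space as traces of closed sets of balls\<close>

lemma closed_hyperspace0_subset: "C \<in> closed_hyperspace0 X d \<Longrightarrow> C \<subseteq> X"
  unfolding closed_hyperspace0_def d_scott_topology_def
  by (auto dest!: closedin_subset simp: topspace_pullback_topology)

lemma closed_hyperspace0I:
  assumes "closedin (ball_topology X d) Z"
  shows "{x \<in> X. (x, 0) \<in> Z} \<in> closed_hyperspace0 X d"
proof -
  have "openin (d_scott_topology X d) (X - {x \<in> X. (x, 0) \<in> Z})"
    unfolding d_scott_topology_def openin_pullback_topology
    by (rule exI[of _ "X \<times> {0..} - Z"])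
      (use assms in \<open>auto simp: closedin_def topspace_scott_topology\<close>)
  moreover have "topspace (d_scott_topology X d) = X"
    unfolding d_scott_topology_def by (auto simp: topspace_pullback_topology topspace_scott_topology)
  ultimately show ?thesis unfolding closed_hyperspace0_def closedin_def by auto
qed

text \<open>The complement of \<open>C\<close> is the trace of an open set \<open>U\<close> of
  balls. If \<open>x\<close> were outside \<open>C\<close>, then \<open>U\<close> would be a
  neighbourhood of \<open>(x, 0)\<close> that misses the embedded copy of \<open>C\<close>.\<close>

lemma closed_hyperspace0_ball_closure:
  assumes C: "C \<in> closed_hyperspace0 X d" and x: "x \<in> X" "(x, 0) \<in> ball_closure X d C"
  shows "x \<in> C"
proof (rule ccontr)
  assume "x \<notin> C"
  have "topspace (d_scott_topology X d) = X"
    unfolding d_scott_topology_def by (auto simp: topspace_pullback_topology topspace_scott_topology)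
  then have "openin (d_scott_topology X d) (X - C)"
    using C unfolding closed_hyperspace0_def closedin_def by auto
  then obtain U where "openin (ball_topology X d) U" "X - C = (\<lambda>x. (x, 0)) -` U \<inter> X"
    unfolding d_scott_topology_def openin_pullback_topology by blast
  moreover have "(x, 0) \<in> U" using \<open>x \<notin> C\<close> x calculation by blast
  ultimately have "\<exists>p. p \<in> (\<lambda>x. (x, 0)) ` C \<and> p \<in> U"
    using x unfolding ball_closure_def in_closure_of by meson
  then obtain y where "y \<in> C" "(y, 0) \<in> U" by auto
  with \<open>X - C = _\<close> closed_hyperspace0_subset[OF C] show False by blast
qed

text \<open>A finite union of sets \<open>\<down>{a}\<close>, each of which is the trace of the set
  of balls below \<open>(a, 0)\<close>. That set is closed, since a supremum of balls below
  \<open>(a, 0)\<close> is again below it.\<close>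

lemma closed_hyperspace0_down:
  assumes "finite F" "F \<subseteq> X"
  shows "specialization_down X d F \<in> closed_hyperspace0 X d"
  using assms
proof (induction F)
  case empty
  then show ?case
    by (simp add: specialization_down_def closed_hyperspace0_def)
next
  case (insert a F)
  \<comment> \<open>The balls not below \<open>(a, 0)\<close>.\<close>
  let ?U = "X \<times> {0..} - {(y, s). d y a + ennreal 0 \<le> ennreal s}"
  have "scott_open (ball_poset X d) ?U" unfolding scott_open_ball_iff
  proof (intro conjI allI impI)
    fix x r y s
    assume "(x, r) \<in> ?U" "y \<in> X" "0 \<le> s" "d x y + ennreal s \<le> ennreal r"
    then show "(y, s) \<in> ?U"
      using ball_le_trans[OF qm, of x y a s r 0] insert.prems by auto
  next
    fix D x r
    assume D: "directed_subset (ball_poset X d) D" and lub: "ball_lub X d D x r"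
      and U: "(x, r) \<in> ?U"
    show "D \<inter> ?U \<noteq> {}"
    proof
      assume "D \<inter> ?U = {}"
      then have "d y a + ennreal 0 \<le> ennreal s" if "(y, s) \<in> D" for y s
        using D that unfolding directed_ball_iff by auto
      then have "d x a + ennreal 0 \<le> ennreal r"
        using ball_lub_least[OF lub, of a 0] insert.prems by blast
      with U show False by auto
    qed
  qed auto
  moreover have "X \<times> {0..} - (X \<times> {0..} - ?U) = ?U" by blast
  ultimately have "closedin (ball_topology X d) (X \<times> {0..} - ?U)"
    unfolding closedin_def topspace_scott_topology openin_scott_topology carrier_ball_poset by auto
  from closed_hyperspace0I[OF this]
  have "{x \<in> X. (x, 0) \<in> X \<times> {0..} - ?U} \<in> closed_hyperspace0 X d" .
  moreover have "{x \<in> X. (x, 0) \<in> X \<times> {0..} - ?U} = specialization_down X d {a}"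
    by (auto simp: specialization_down_def)
  ultimately have "closedin (d_scott_topology X d) (specialization_down X d {a})"
    by (simp only: closed_hyperspace0_def mem_Collect_eq)
  moreover have "closedin (d_scott_topology X d) (specialization_down X d F)"
    using insert by (simp add: closed_hyperspace0_def)
  moreover have "specialization_down X d (insert a F) =
      specialization_down X d {a} \<union> specialization_down X d F"
    by (auto simp: specialization_down_def)
  ultimately show ?case by (simp add: closed_hyperspace0_def closedin_Un)
qed

lemma subset_specialization_down: "F \<subseteq> X \<Longrightarrow> F \<subseteq> specialization_down X d F"
  unfolding specialization_down_def using refl by blast

lemma specialization_down_subset: "specialization_down X d F \<subseteq> X"
  by (auto simp: specialization_down_def)

end

section \<open>Algebraic spaces\<close>

locale yoneda_algebraic = yoneda_qms X d for X :: "'a set" and d +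
  fixes B :: "'a set"
  assumes sb: "strong_basis X d B"
begin

lemma basis_center: "b \<in> B \<Longrightarrow> center_point X d b"
  using sb unfolding strong_basis_def by simp

lemma basis_in [simp]: "b \<in> B \<Longrightarrow> b \<in> X"
  using basis_center unfolding center_point_iff by simp

lemma basis_lub:
  assumes "x \<in> X"
  obtains D where "directed_subset (ball_poset X d) D" "ball_lub X d D x 0"
    "\<And>y s. (y, s) \<in> D \<Longrightarrow> y \<in> B \<and> 0 \<le> s \<and> d y x \<le> ennreal s"
proof -
  obtain D where D: "directed_subset (ball_poset X d) D" "fst ` D \<subseteq> B"
      "least (ball_poset X d) (x, 0) (Upper (ball_poset X d) D)"
    using sb assms unfolding strong_basis_def by meson
  have DX: "D \<subseteq> X \<times> {0..}" using D(1) unfolding directed_ball_iff by simp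
  then have lub: "ball_lub X d D x 0" using D(3) least_ball_iff[OF DX] by simp
  have "y \<in> B \<and> 0 \<le> s \<and> d y x \<le> ennreal s" if "(y, s) \<in> D" for y s
    using that D(2) DX ball_lub_upper[OF lub that] by force
  with that D(1) lub show ?thesis by metis
qed

text \<open>In a directed family of basis balls with supremum \<open>(x, 0)\<close>, one member
  satisfies the strict bound at \<open>a\<close> because \<open>a\<close> is a center point, and
  another has radius below \<open>e\<close>. A member above both has the two properties at
  once.\<close>

lemma basis_interpolate:
  assumes a: "center_point X d a" and x: "x \<in> X" and less: "d a x < ennreal s" and e: "0 < e"
  obtains b m where "b \<in> B" "0 \<le> m" "m < e" "d b x \<le> ennreal m" "d a b + ennreal m < ennreal s"
proof -
  obtain D where D: "directed_subset (ball_poset X d) D" "ball_lub X d D x 0"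
    "\<And>y s. (y, s) \<in> D \<Longrightarrow> y \<in> B \<and> 0 \<le> s \<and> d y x \<le> ennreal s"
    using basis_lub[OF x] by metis
  have "d a x + ennreal 0 < ennreal s" using less by simp
  then obtain y u where y: "(y, u) \<in> D" "d a y + ennreal u < ennreal s"
    by (rule center_point_ball_lub[OF a D(1,2)])
  obtain z v where z: "(z, v) \<in> D" "v < e"
    using lub_small_radius[OF D(1,2) e] .
  obtain b m where b: "(b, m) \<in> D" "d y b + ennreal m \<le> ennreal u" "d z b + ennreal m \<le> ennreal v"
    using D(1) y(1) z(1) unfolding directed_ball_iff by meson
  have "0 \<le> m" "0 \<le> v" "b \<in> X" "y \<in> X" "a \<in> X"
    using D(3)[OF b(1)] D(3)[OF z(1)] D(3)[OF y(1)] a unfolding center_point_iff by auto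
  then have "m < e" using b(3) z(2) by (auto simp: ennreal_add_le_iff)
  have "d a b + ennreal m \<le> d a y + d y b + ennreal m"
    by (intro add_right_mono triangle) fact+
  also have "\<dots> \<le> d a y + ennreal u"
    using b(2) by (metis add.assoc add_left_mono)
  also note y(2)
  finally show ?thesis using that[of b m] D(3)[OF b(1)] \<open>m < e\<close> by blast
qed

section \<open>Closed sets compared through their distances from basis points\<close>

text \<open>From left to right, if \<open>x\<close> is in \<open>C\<close> and
  \<open>r = d b x\<close> is finite, then \<open>(b, r + t)\<close> lies below
  \<open>(x, t)\<close> and so is in the closure of \<open>C'\<close>. Conversely, the basis balls
  with supremum \<open>(x, 0)\<close>, enlarged by \<open>t\<close>, lie in that closure, and by
  \<open>lub_shift\<close> their supremum is \<open>(x, t)\<close>.\<close>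

lemma hausdorff_le_iff_basis:
  assumes C: "C \<subseteq> X" "C' \<subseteq> X" and t: "0 \<le> t"
  shows "hausdorff_quasi_metric X d C C' \<le> ennreal t \<longleftrightarrow>
    (\<forall>b\<in>B. center_dist b C' \<le> center_dist b C + ennreal t)"
  unfolding hausdorff_le_iff[OF C(1) t]
proof (intro iffI ballI)
  fix b assume cl: "\<forall>x\<in>C. (x, t) \<in> ball_closure X d C'" and b: "b \<in> B"
  have "center_dist b C' \<le> d b x + ennreal t" if x: "x \<in> C" for x
  proof (cases "d b x" rule: ennreal_cases)
    case (real r)
    have "(x, t) \<in> ball_closure X d C'" "d b x + ennreal t \<le> ennreal (r + t)" "0 \<le> r + t"
      using cl x real t by auto
    then have "(b, r + t) \<in> ball_closure X d C'"
      using closedin_down[OF closedin_ball_closure] basis_in[OF b] by metis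
    then show ?thesis
      using center_ball_closure_iff[OF basis_center[OF b] C(2)] t real by simp
  qed simp
  then show "center_dist b C' \<le> center_dist b C + ennreal t"
    unfolding center_dist_def[of b C] INF_add_ennreal_const[symmetric] by (rule INF_greatest)
next
  fix x assume le: "\<forall>b\<in>B. center_dist b C' \<le> center_dist b C + ennreal t" and x: "x \<in> C"
  obtain D where D: "directed_subset (ball_poset X d) D" "ball_lub X d D x 0"
    "\<And>y s. (y, s) \<in> D \<Longrightarrow> y \<in> B \<and> 0 \<le> s \<and> d y x \<le> ennreal s"
    using basis_lub[of x] x C by (metis subsetD)
  let ?D = "(\<lambda>(y, s). (y, s + t)) ` D"
  show "(x, t) \<in> ball_closure X d C'"
  proof (rule closedin_lub[OF closedin_ball_closure])
    show "directed_subset (ball_poset X d) ?D"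
      using D(3) t by (intro directed_shift[OF D(1)]) force
    show "ball_lub X d ?D x t" by (rule lub_shift[OF D(1,2) t])
    show "?D \<subseteq> ball_closure X d C'"
    proof clarify
      fix y s assume "(y, s) \<in> D"
      from D(3)[OF this] have y: "y \<in> B" "0 \<le> s" "d y x \<le> ennreal s" by auto
      have "center_dist y C' \<le> center_dist y C + ennreal t" using le y by simp
      also have "\<dots> \<le> d y x + ennreal t" by (intro add_right_mono center_dist_lower x)
      also have "\<dots> \<le> ennreal s + ennreal t" by (intro add_right_mono y)
      also have "\<dots> = ennreal (s + t)" using y t by simp
      finally show "(y, s + t) \<in> ball_closure X d C'"
        using center_ball_closure_iff[OF basis_center[OF y(1)] C(2), of "s + t"] y t by simp
    qed
  qed
qed

text \<open>The condition \<open>s \<le> r\<close> must be stated separately: for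
  \<open>C = C' = {}\<close> all the distances are infinite, and the inequalities over
  \<open>B\<close> say nothing about the radii.\<close>

lemma hausdorff_add_le_iff:
  assumes C: "C \<subseteq> X" "C' \<subseteq> X" and r: "0 \<le> r" "0 \<le> s"
  shows "hausdorff_quasi_metric X d C C' + ennreal s \<le> ennreal r \<longleftrightarrow>
    s \<le> r \<and> (\<forall>b\<in>B. center_dist b C' + ennreal s \<le> center_dist b C + ennreal r)"
proof (cases "s \<le> r")
  case True
  have "center_dist b C' + ennreal s \<le> center_dist b C + ennreal r \<longleftrightarrow>
      center_dist b C' \<le> center_dist b C + ennreal (r - s)" for b
    using ennreal_add_shift[OF r(2) True, of "center_dist b C"]
    by (metis ennreal_add_const_le_iff)
  then show ?thesis
    using True unfolding ennreal_add_le_iff[OF r] by (simp add: hausdorff_le_iff_basis[OF C])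
qed (simp add: ennreal_add_le_iff[OF r])

text \<open>The basis balls \<open>(y, s)\<close> with supremum \<open>(x, 0)\<close> satisfy
  \<open>center_dist y C \<le> d y x \<le> s\<close>, hence lie in the closure of \<open>C\<close>,
  and so does \<open>(x, 0)\<close>. A closed set can thus be recovered from its distances from
  \<open>B\<close>.\<close>

lemma closed_mem_iff:
  assumes C: "C \<in> closed_hyperspace0 X d" and x: "x \<in> X"
  shows "x \<in> C \<longleftrightarrow> (\<forall>b\<in>B. center_dist b C \<le> d b x)"
proof
  assume le: "\<forall>b\<in>B. center_dist b C \<le> d b x"
  obtain D where D: "directed_subset (ball_poset X d) D" "ball_lub X d D x 0"
    "\<And>y s. (y, s) \<in> D \<Longrightarrow> y \<in> B \<and> 0 \<le> s \<and> d y x \<le> ennreal s"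
    using basis_lub[OF x] by metis
  have "(y, s) \<in> ball_closure X d C" if "(y, s) \<in> D" for y s
    using D(3)[OF that] le center_ball_closure_iff[OF basis_center closed_hyperspace0_subset[OF C]]
    by (meson order_trans)
  then have "(x, 0) \<in> ball_closure X d C"
    by (intro closedin_lub[OF closedin_ball_closure D(1) _ D(2)]) auto
  then show "x \<in> C" by (rule closed_hyperspace0_ball_closure[OF C x])
qed (auto intro: center_dist_lower)

text \<open>Through the comparison over \<open>B\<close> the triangle inequality amounts to adding
  two shifts, and antisymmetry holds because the distances from \<open>B\<close> determine a closed
  set. An arbitrary \<open>Y\<close> covers both hyperspaces.\<close>

lemma quasi_metric_space_hyperspace:
  assumes Y: "Y \<subseteq> closed_hyperspace0 X d"
  shows "quasi_metric_space Y (hausdorff_quasi_metric X d)"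
  unfolding quasi_metric_space_def
proof (intro conjI ballI impI)
  let ?h = "hausdorff_quasi_metric X d"
  have sub: "C \<subseteq> X" if "C \<in> Y" for C using Y that closed_hyperspace0_subset by auto
  have zero: "?h C C' = 0 \<longleftrightarrow> (\<forall>b\<in>B. center_dist b C' \<le> center_dist b C)"
    if "C \<in> Y" "C' \<in> Y" for C C'
    using hausdorff_le_iff_basis[OF sub[OF that(1)] sub[OF that(2)], of 0] by simp
  show "?h C C = 0" if "C \<in> Y" for C using zero[OF that that] by simp
  show "?h C1 C3 \<le> ?h C1 C2 + ?h C2 C3" if in_Y: "C1 \<in> Y" "C2 \<in> Y" "C3 \<in> Y" for C1 C2 C3
  proof (cases "?h C1 C2" rule: ennreal_cases)
    case t: (real t)
    show ?thesis
    proof (cases "?h C2 C3" rule: ennreal_cases)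
      case u: (real u)
      have "center_dist b C3 \<le> center_dist b C1 + ennreal (t + u)" if b: "b \<in> B" for b
      proof -
        have "?h C1 C2 \<le> ennreal t" "?h C2 C3 \<le> ennreal u" using t u by auto
        then have 1: "center_dist b C2 \<le> center_dist b C1 + ennreal t"
          and 2: "center_dist b C3 \<le> center_dist b C2 + ennreal u"
          using b t(1) u(1) in_Y by (simp_all add: hausdorff_le_iff_basis sub)
        note 2
        also have "center_dist b C2 + ennreal u \<le> center_dist b C1 + ennreal t + ennreal u"
          using 1 by (rule add_right_mono)
        finally show ?thesis using t(1) u(1) by (simp add: add.assoc)
      qed
      then have "?h C1 C3 \<le> ennreal (t + u)"
        using t(1) u(1) in_Y by (subst hausdorff_le_iff_basis) (auto simp: sub simp del: ennreal_plus)
      then show ?thesis using t u by simp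
    qed simp
  qed simp
  show "C = C'" if "C \<in> Y" "C' \<in> Y" "?h C C' = 0" "?h C' C = 0" for C C'
  proof -
    have eq: "\<forall>b\<in>B. center_dist b C = center_dist b C'"
      using zero that by (meson order_antisym)
    have "x \<in> C \<longleftrightarrow> x \<in> C'" if "x \<in> X" for x
      using closed_mem_iff[of C x] closed_mem_iff[of C' x] eq Y \<open>C \<in> Y\<close> \<open>C' \<in> Y\<close> that by auto
    then show ?thesis using sub that by blast
  qed
qed

text \<open>Any basis ball below \<open>(x, 0)\<close> with \<open>x\<close> in \<open>C\<close> has
  a center at finite distance from \<open>C\<close>, while an infimum over the empty set is
  infinite. This reads non-emptiness off the distance function.\<close>

lemma nonempty_iff:
  assumes "C \<subseteq> X"
  shows "C \<noteq> {} \<longleftrightarrow> (\<exists>b\<in>B. center_dist b C < \<infinity>)"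
proof
  assume "C \<noteq> {}"
  then obtain x where x: "x \<in> C" by blast
  then obtain D where D: "directed_subset (ball_poset X d) D"
    "\<And>y s. (y, s) \<in> D \<Longrightarrow> y \<in> B \<and> 0 \<le> s \<and> d y x \<le> ennreal s"
    using basis_lub[of x] assms by (metis subsetD)
  then obtain b s where "(b, s) \<in> D" unfolding directed_ball_iff by fastforce
  then have "b \<in> B" "d b x \<le> ennreal s" using D(2) by auto
  then show "\<exists>b\<in>B. center_dist b C < \<infinity>"
    using center_dist_lower[OF x, of b] by (metis ennreal_less_top infinity_ennreal_def order_le_less_trans)
qed (auto simp: center_dist_def)

text \<open>The interpolation property produces an increasing chain of balls, starting at any ball
  \<open>(b, t)\<close> with \<open>f b < t\<close>, whose supremum is a point of \<open>C\<close>.\<close>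

lemma center_dist_realize:
  fixes f :: "'a \<Rightarrow> ennreal"
  assumes lip: "\<And>b c. b \<in> B \<Longrightarrow> c \<in> B \<Longrightarrow> f c \<le> d c b + f b"
    and interp: "\<And>b s e. b \<in> B \<Longrightarrow> f b < ennreal s \<Longrightarrow> 0 < e \<Longrightarrow>
      \<exists>c\<in>B. \<exists>m\<ge>0. m < e \<and> f c \<le> ennreal m \<and> d b c + ennreal m < ennreal s"
  defines "C \<equiv> {x \<in> X. \<forall>b\<in>B. f b \<le> d b x}"
  shows "C \<in> closed_hyperspace0 X d" and "\<And>b. b \<in> B \<Longrightarrow> center_dist b C = f b"
proof -
  \<comment> \<open>\<open>C\<close> is the trace of \<open>?Z\<close>, which is closed: its
    complement is the union of the open sets \<open>U (b, e)\<close> around basis points with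
    \<open>e \<le> f b\<close>.\<close>
  let ?Z = "{(x, s). x \<in> X \<and> 0 \<le> s \<and> (\<forall>b\<in>B. f b \<le> d b x + ennreal s)}"
  define U where "U = (\<lambda>(b, e). {(y, s). y \<in> X \<and> 0 \<le> s \<and> d b y + ennreal s < ennreal e})"
  define I where "I = {(b, e). b \<in> B \<and> 0 < e \<and> ennreal e \<le> f b}"
  have "openin (ball_topology X d) (\<Union>(U ` I))"
  proof (rule openin_Union)
    fix W assume "W \<in> U ` I"
    then show "openin (ball_topology X d) W"
      using basis_center unfolding U_def I_def center_point_iff openin_scott_topology by auto
  qed
  moreover have "X \<times> {0..} - ?Z = \<Union>(U ` I)"
  proof (intro equalityI subsetI)
    fix p assume "p \<in> X \<times> {0..} - ?Z"
    then obtain x s where p: "p = (x, s)" "x \<in> X" "0 \<le> s" "\<not> (\<forall>b\<in>B. f b \<le> d b x + ennreal s)"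
      by auto
    then obtain b where b: "b \<in> B" "d b x + ennreal s < f b" by (auto simp: not_le)
    obtain e where e: "0 < e" "d b x + ennreal s < ennreal e" "ennreal e < f b"
      using ennreal_real_between[OF b(2)] .
    then have "(b, e) \<in> I" "p \<in> U (b, e)" using p b unfolding I_def U_def by auto
    then show "p \<in> \<Union>(U ` I)" by blast
  next
    fix p assume "p \<in> \<Union>(U ` I)"
    then obtain b e where "(b, e) \<in> I" "p \<in> U (b, e)" by auto
    then obtain x s where p: "p = (x, s)" "x \<in> X" "0 \<le> s" "b \<in> B"
      "d b x + ennreal s < ennreal e" "ennreal e \<le> f b"
      unfolding I_def U_def by auto
    then have "\<not> f b \<le> d b x + ennreal s" by (meson leD order_less_le_trans)
    with p show "p \<in> X \<times> {0..} - ?Z" by auto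
  qed
  ultimately have "closedin (ball_topology X d) ?Z"
    unfolding closedin_def topspace_scott_topology carrier_ball_poset by auto
  then have "{x \<in> X. (x, 0) \<in> ?Z} \<in> closed_hyperspace0 X d"
    by (rule closed_hyperspace0I)
  moreover have "{x \<in> X. (x, 0) \<in> ?Z} = C" unfolding C_def by auto
  ultimately show "C \<in> closed_hyperspace0 X d" by simp

  fix b assume b: "b \<in> B"
  have "f b \<le> center_dist b C"
    unfolding center_dist_def C_def using b by (intro INF_greatest) auto
  moreover have "center_dist b C \<le> f b"
  proof (rule ccontr)
    assume "\<not> center_dist b C \<le> f b"
    then have "f b < center_dist b C" by simp
    then obtain t where t: "0 < t" "f b < ennreal t" "ennreal t < center_dist b C"
      by (rule ennreal_real_between)
    \<comment> \<open>The invariant \<open>P\<close> keeps \<open>f c < s\<close>, so that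
      interpolation applies again, and fixes the first ball as \<open>(b, t)\<close>. The relation
      \<open>Q\<close> makes the chain increase and its radii tend to 0.\<close>
    define P where "P = (\<lambda>(n::nat) (c, s). c \<in> B \<and> 0 \<le> s \<and> f c < ennreal s \<and> (n = 0 \<longrightarrow> (c, s) = (b, t)))"
    define Q where "Q = (\<lambda>(n::nat) (c, s) (c', s').
      d c c' + ennreal s' \<le> ennreal s \<and> s' < inverse (real (Suc n)))"
    have "\<exists>p. \<forall>n. P n (p n) \<and> Q n (p n) (p (Suc n))"
    proof (rule dependent_nat_choice)
      show "\<exists>x. P 0 x" using b t unfolding P_def by auto
    next
      fix x n assume P: "P n x"
      obtain c s where x: "x = (c, s)" by (cases x)
      then have c: "c \<in> B" "0 \<le> s" "f c < ennreal s" using P unfolding P_def by auto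
      define e where "e = inverse (real (Suc n))"
      have e: "0 < e" unfolding e_def by simp
      obtain c' m where c': "c' \<in> B" "0 \<le> m" "m < e" "f c' \<le> ennreal m" "d c c' + ennreal m < ennreal s"
        using interp[OF c(1,3) e] by blast
      obtain u where u: "d c c' = ennreal u" "0 \<le> u" "u + m < s"
        using c'(2,5) by (cases "d c c'" rule: ennreal_cases)
          (auto simp: ennreal_less_iff simp flip: ennreal_plus)
      \<comment> \<open>The midpoint of \<open>m\<close> and \<open>e\<close> makes room for the
        strict inequality \<open>f c' < s'\<close>, and the bound \<open>s - u\<close> keeps the new
        ball above the old one.\<close>
      define s' where "s' = min ((m + e) / 2) (s - u)"
      have s': "m < s'" "s' < e" "u + s' \<le> s" "0 \<le> s'"
        using u c'(2,3) unfolding s'_def by (auto simp: min_def field_simps)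
      have "f c' < ennreal s'" using c' s' by (metis ennreal_less_iff order_le_less_trans)
      moreover have "d c c' + ennreal s' \<le> ennreal s"
        using u s' by (simp flip: ennreal_plus)
      ultimately have "P (Suc n) (c', s') \<and> Q n x (c', s')"
        using c' s' unfolding P_def Q_def x e_def by auto
      then show "\<exists>y. P (Suc n) y \<and> Q n x y" by blast
    qed
    then obtain p where p: "\<And>n. P n (p n)" "\<And>n. Q n (p n) (p (Suc n))" by blast
    define c where "c n = fst (p n)" for n
    define s where "s n = snd (p n)" for n
    have p_eq: "p n = (c n, s n)" for n unfolding c_def s_def by simp
    have c: "c n \<in> B" "0 \<le> s n" "f (c n) < ennreal (s n)" for n
      using p(1)[of n] unfolding P_def p_eq by auto
    have start: "c 0 = b" "s 0 = t" using p(1)[of 0] unfolding P_def p_eq by auto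
    have link: "d (c n) (c (Suc n)) + ennreal (s (Suc n)) \<le> ennreal (s n)"
      and small: "s (Suc n) < inverse (real (Suc n))" for n
      using p(2)[of n] unfolding Q_def p_eq by auto
    have chain: "d (c n) (c k) + ennreal (s k) \<le> ennreal (s n)" if "n \<le> k" for n k
      using that
    proof (induction k rule: dec_induct)
      case base
      then show ?case using c by simp
    next
      case (step k)
      show ?case
        by (rule ball_le_trans[OF qm _ _ _ step.IH link])
          (use c in auto)
    qed
    let ?D = "range (\<lambda>n. (c n, s n))"
    have D: "directed_subset (ball_poset X d) ?D"
      unfolding directed_ball_iff
    proof (intro conjI allI impI)
      fix x r y u assume "(x, r) \<in> ?D" "(y, u) \<in> ?D"
      then obtain n k where "x = c n" "r = s n" "y = c k" "u = s k" by auto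
      then show "\<exists>z v. (z, v) \<in> ?D \<and> d x z + ennreal v \<le> ennreal r \<and> d y z + ennreal v \<le> ennreal u"
        using chain[of n "max n k"] chain[of k "max n k"] by auto
    qed (use c in auto)
    then obtain x r where lub: "ball_lub X d ?D x r" by (rule directed_has_lub)
    have x: "x \<in> X" "0 \<le> r" using lub unfolding ball_lub_def by auto
    have up: "r \<le> s n \<and> d (c n) x \<le> ennreal (s n)" for n
    proof -
      have le: "d (c n) x + ennreal r \<le> ennreal (s n)" by (rule ball_lub_upper[OF lub]) auto
      then have "d (c n) x \<le> ennreal (s n)" by (meson le_iff_add order_trans)
      with le show ?thesis using ennreal_add_le_iff[OF c(2) x(2)] by blast
    qed
    have "r = 0"
    proof (rule ccontr)
      assume "r \<noteq> 0"
      then obtain n where "inverse (real (Suc n)) < r" using x reals_Archimedean[of r] by auto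
      then show False using small[of n] up[of "Suc n"] by auto
    qed
    \<comment> \<open>If \<open>d a x < u < f a\<close>, the center point \<open>a\<close> already
      sees some \<open>d a (c n) + s n < u\<close> in the chain, while \<open>lip\<close> and
      \<open>f (c n) < s n\<close> give \<open>f a \<le> d a (c n) + s n\<close>.\<close>
    have "f a \<le> d a x" if a: "a \<in> B" for a
    proof (rule ccontr)
      assume "\<not> f a \<le> d a x"
      then have "d a x < f a" by simp
      then obtain u where u: "d a x < ennreal u" "ennreal u < f a" by (rule ennreal_real_between)
      then have "d a x + ennreal r < ennreal u" using \<open>r = 0\<close> by simp
      then obtain y v where "(y, v) \<in> ?D" "d a y + ennreal v < ennreal u"
        by (rule center_point_ball_lub[OF basis_center[OF a] D lub])
      then obtain n where n: "d a (c n) + ennreal (s n) < ennreal u" by auto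
      have "f a \<le> d a (c n) + f (c n)" by (rule lip[OF c(1) a])
      also have "\<dots> \<le> d a (c n) + ennreal (s n)"
        using c(3)[of n] by (intro add_left_mono) simp
      also note n
      finally show False using u(2) by simp
    qed
    then have "x \<in> C" using x unfolding C_def by simp
    then have "center_dist b C \<le> d b x" by (rule center_dist_lower)
    also have "\<dots> \<le> ennreal t" using up[of 0] start by simp
    finally show False using t by simp
  qed
  ultimately show "center_dist b C = f b" by (rule order_antisym[rotated])
qed

section \<open>Suprema of directed families of balls around closed sets\<close>

abbreviation (input) dH :: "'a set \<Rightarrow> 'a set \<Rightarrow> ennreal" where
  "dH \<equiv> hausdorff_quasi_metric X d"

lemma directed_hyperspace_join:
  assumes Y: "Y \<subseteq> closed_hyperspace0 X d" and D: "directed_subset (ball_poset Y dH) D"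
    and "(C1, r1) \<in> D" "(C2, r2) \<in> D"
  obtains C r where "(C, r) \<in> D" "r \<le> r1" "r \<le> r2"
    "\<And>b. b \<in> B \<Longrightarrow> center_dist b C + ennreal r \<le> center_dist b C1 + ennreal r1"
    "\<And>b. b \<in> B \<Longrightarrow> center_dist b C + ennreal r \<le> center_dist b C2 + ennreal r2"
proof -
  obtain C r where C: "(C, r) \<in> D" "dH C1 C + ennreal r \<le> ennreal r1" "dH C2 C + ennreal r \<le> ennreal r2"
    using D assms(3,4) unfolding directed_ball_iff by meson
  have "C' \<subseteq> X \<and> 0 \<le> r'" if "(C', r') \<in> D" for C' r'
    using that D Y closed_hyperspace0_subset unfolding directed_ball_iff by blast
  then show ?thesis using that[OF C(1)] C assms(3,4) by (simp add: hausdorff_add_le_iff)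
qed

text \<open>The infimum \<open>f\<close> of the shifted distance functions satisfies both hypotheses
  of \<open>center_dist_realize\<close>. The Lipschitz bound passes to infima; interpolation is
  inherited from a single member that nearly attains both the infimum at \<open>b\<close> and the
  infimum of the radii.\<close>

lemma hyperspace_limit:
  assumes Y: "Y \<subseteq> closed_hyperspace0 X d" and D: "directed_subset (ball_poset Y dH) D"
  obtains C where "C \<in> closed_hyperspace0 X d"
    "\<And>b. b \<in> B \<Longrightarrow> center_dist b C + ennreal (Inf (snd ` D)) =
      (INF p\<in>D. center_dist b (fst p) + ennreal (snd p))"
proof -
  let ?\<rho> = "Inf (snd ` D)"
  have DY: "C \<subseteq> X \<and> 0 \<le> r" if "(C, r) \<in> D" for C r
    using that D Y closed_hyperspace0_subset unfolding directed_ball_iff by blast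
  have ne: "snd ` D \<noteq> {}" and bdd: "bdd_below (snd ` D)"
    using D unfolding directed_ball_iff by (auto intro!: bdd_belowI[of _ 0])
  have \<rho>0: "0 \<le> ?\<rho>" using DY by (intro cInf_greatest[OF ne]) auto
  have \<rho>: "?\<rho> \<le> r" if "(C, r) \<in> D" for C r
    using that by (intro cInf_lower bdd) force
  \<comment> \<open>The limit radius is subtracted from each real radius, where the difference is
    non-negative, and not from the infimum in \<open>ennreal\<close>.\<close>
  define f where "f b = (INF p\<in>D. center_dist b (fst p) + ennreal (snd p - ?\<rho>))" for b
  have f_le: "f b \<le> center_dist b C + ennreal (r - ?\<rho>)" if "(C, r) \<in> D" for b C r
    unfolding f_def using INF_lower[OF that, of "\<lambda>p. center_dist b (fst p) + ennreal (snd p - ?\<rho>)"]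
    by simp
  have eq: "f b + ennreal ?\<rho> = (INF p\<in>D. center_dist b (fst p) + ennreal (snd p))" for b
  proof -
    have "center_dist b (fst p) + ennreal (snd p - ?\<rho>) + ennreal ?\<rho> =
        center_dist b (fst p) + ennreal (snd p)" if "p \<in> D" for p
      using \<rho>[of "fst p" "snd p"] that by (intro ennreal_add_shift \<rho>0) simp
    then show ?thesis
      unfolding f_def INF_add_ennreal_const[symmetric] by (rule INF_cong[OF HOL.refl])
  qed
  have lip: "f c \<le> d c b + f b" if "b \<in> B" "c \<in> B" for b c
  proof (cases "d c b" rule: ennreal_cases)
    case (real t)
    have "f c \<le> (INF p\<in>D. center_dist b (fst p) + ennreal (snd p - ?\<rho>) + ennreal t)"
    proof (rule INF_greatest)
      fix p assume p: "p \<in> D"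
      obtain C r where [simp]: "p = (C, r)" by (cases p)
      have "f c \<le> center_dist c C + ennreal (r - ?\<rho>)" using p by (intro f_le) simp
      also have "\<dots> \<le> d c b + center_dist b C + ennreal (r - ?\<rho>)"
        using DY[of C r] p that by (intro add_right_mono center_dist_Lipschitz) auto
      finally show "f c \<le> center_dist b (fst p) + ennreal (snd p - ?\<rho>) + ennreal t"
        using real by (simp add: add_ac)
    qed
    then show ?thesis unfolding INF_add_ennreal_const real f_def[of b] by (simp add: add_ac)
  qed simp
  have interp: "\<exists>c\<in>B. \<exists>m\<ge>0. m < e \<and> f c \<le> ennreal m \<and> d b c + ennreal m < ennreal s"
    if b: "b \<in> B" and less: "f b < ennreal s" and e: "0 < e" for b s e
  proof -
    obtain C1 r1 where 1: "(C1, r1) \<in> D" "center_dist b C1 + ennreal (r1 - ?\<rho>) < ennreal s"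
      using less unfolding f_def INF_less_iff by auto
    have "?\<rho> < ?\<rho> + e / 2" using e by simp
    then have "\<exists>r\<in>snd ` D. r < ?\<rho> + e / 2"
      by (simp only: cInf_less_iff[OF ne bdd])
    then obtain C2 r2 where 2: "(C2, r2) \<in> D" "r2 < ?\<rho> + e / 2"
      by auto
    obtain C r where C: "(C, r) \<in> D" "r \<le> r2"
      "center_dist b C + ennreal r \<le> center_dist b C1 + ennreal r1"
      using directed_hyperspace_join[OF Y D 1(1) 2(1)] b by metis
    \<comment> \<open>The error \<open>e\<close> is split in two: one half bounds the excess radius
      \<open>?t\<close> of the chosen member, the other the radius \<open>m\<close> from
      interpolation around a point of \<open>C\<close>. Then
      \<open>f c \<le> m + ?t < e\<close>.\<close>
    let ?t = "r - ?\<rho>"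
    have t: "0 \<le> ?t" "?t < e / 2" using \<rho>[OF C(1)] C(2) 2(2) by auto
    have "center_dist b C + ennreal ?t \<le> center_dist b C1 + ennreal (r1 - ?\<rho>)"
      using C(3) ennreal_add_shift[OF \<rho>0 \<rho>[OF C(1)], of "center_dist b C"]
        ennreal_add_shift[OF \<rho>0 \<rho>[OF 1(1)], of "center_dist b C1"]
      by (metis ennreal_add_const_le_iff)
    then have "center_dist b C < ennreal (s - ?t)"
      using 1(2) unfolding ennreal_less_diff_iff[OF t(1)] by (rule order_le_less_trans)
    then obtain x where x: "x \<in> C" "d b x < ennreal (s - ?t)" by (rule center_dist_lessE)
    then have "x \<in> X" using DY C(1) by blast
    moreover have "0 < e / 2" using e by simp
    ultimately obtain c m where c: "c \<in> B" "0 \<le> m" "m < e / 2" "d c x \<le> ennreal m"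
      "d b c + ennreal m < ennreal (s - ?t)"
      using basis_interpolate[OF basis_center[OF b] _ x(2)] by metis
    have "f c \<le> center_dist c C + ennreal ?t" by (rule f_le[OF C(1)])
    also have "\<dots> \<le> ennreal m + ennreal ?t"
      by (intro add_right_mono order_trans[OF center_dist_lower[OF x(1)] c(4)])
    also have "\<dots> = ennreal (m + ?t)" using c t by simp
    finally have "f c \<le> ennreal (m + ?t)" .
    moreover have "d b c + ennreal (m + ?t) < ennreal s"
      using c(5) c(2) t unfolding ennreal_less_diff_iff[OF t(1)] by (simp add: add.assoc)
    moreover have "0 \<le> m + ?t" "m + ?t < e" using c t by auto
    ultimately show ?thesis using c(1) by blast
  qed
  let ?C = "{x \<in> X. \<forall>b\<in>B. f b \<le> d b x}"
  have "?C \<in> closed_hyperspace0 X d" "\<And>b. b \<in> B \<Longrightarrow> center_dist b ?C = f b"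
    by (rule center_dist_realize[OF lip interp]; assumption)+
  then show ?thesis using that[of ?C] eq by simp
qed

text \<open>By \<open>hausdorff_add_le_iff\<close> the order on balls is the pointwise order on
  distances plus radii, together with the order on radii. A ball that attains both infima is
  therefore the supremum.\<close>

lemma hyperspace_lub:
  assumes Y: "Y \<subseteq> closed_hyperspace0 X d" and D: "directed_subset (ball_poset Y dH) D"
    and C: "C \<in> Y" and eq: "\<And>b. b \<in> B \<Longrightarrow> center_dist b C + ennreal (Inf (snd ` D)) =
      (INF p\<in>D. center_dist b (fst p) + ennreal (snd p))"
  shows "ball_lub Y dH D C (Inf (snd ` D))"
proof -
  let ?\<rho> = "Inf (snd ` D)"
  have sub: "C' \<subseteq> X" if "C' \<in> Y" for C' using that Y closed_hyperspace0_subset by blast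
  have DY: "C \<in> Y \<and> 0 \<le> r" if "(C, r) \<in> D" for C r
    using that D unfolding directed_ball_iff by blast
  have ne: "snd ` D \<noteq> {}" and bdd: "bdd_below (snd ` D)"
    using D unfolding directed_ball_iff by (auto intro!: bdd_belowI[of _ 0])
  have \<rho>0: "0 \<le> ?\<rho>" using DY by (intro cInf_greatest[OF ne]) auto
  show ?thesis unfolding ball_lub_def
  proof (intro conjI allI ballI impI C \<rho>0)
    fix C' r assume C': "(C', r) \<in> D"
    then have "?\<rho> \<le> r" by (intro cInf_lower bdd) force
    moreover have "center_dist b C + ennreal ?\<rho> \<le> center_dist b C' + ennreal r" if "b \<in> B" for b
      unfolding eq[OF that] using INF_lower[OF C', of "\<lambda>p. center_dist b (fst p) + ennreal (snd p)"]
      by simp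
    ultimately show "dH C' C + ennreal ?\<rho> \<le> ennreal r"
      using DY[OF C'] \<rho>0 C by (subst hausdorff_add_le_iff) (auto simp: sub)
  next
    fix C' t assume C': "C' \<in> Y" and t: "0 \<le> t"
      and ub: "\<forall>E s. (E, s) \<in> D \<longrightarrow> dH E C' + ennreal t \<le> ennreal s"
    have ub': "t \<le> s \<and> (\<forall>b\<in>B. center_dist b C' + ennreal t \<le> center_dist b E + ennreal s)"
      if "(E, s) \<in> D" for E s
      using ub that DY[OF that] t C' hausdorff_add_le_iff[of E C' s t] sub by meson
    have "t \<le> ?\<rho>" using ub' by (intro cInf_greatest[OF ne]) auto
    moreover have "center_dist b C' + ennreal t \<le> center_dist b C + ennreal ?\<rho>" if "b \<in> B" for b
      unfolding eq[OF that] using ub' that by (intro INF_greatest) auto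
    ultimately show "dH C C' + ennreal t \<le> ennreal ?\<rho>"
      using \<rho>0 t C C' by (subst hausdorff_add_le_iff) (auto simp: sub)
  qed
qed

end

section \<open>Hyperspaces\<close>

text \<open>\<open>Y\<close> stands for either hyperspace, so that one argument serves both; the
  cases differ only in whether the empty set belongs to \<open>Y\<close>.\<close>

locale hyperspace = yoneda_algebraic X d B for X :: "'a set" and d and B +
  fixes Y :: "'a set set"
  assumes Y_cases: "Y = closed_hyperspace0 X d \<or> Y = closed_hyperspace X d"
begin

lemma Y_sub: "Y \<subseteq> closed_hyperspace0 X d"
  using Y_cases unfolding closed_hyperspace_def by auto

lemma Y_X: "C \<in> Y \<Longrightarrow> C \<subseteq> X"
  using Y_sub closed_hyperspace0_subset by blast

lemmas qm_Y = quasi_metric_space_hyperspace[OF Y_sub]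

text \<open>The limit set must be shown to belong to \<open>Y\<close>. If a member \<open>E\<close>
  is non-empty, it has finite distance from some \<open>b\<close>; the infimum at \<open>b\<close>
  is then finite too, which makes the limit non-empty.\<close>

lemma lub_exists:
  assumes D: "directed_subset (ball_poset Y dH) D"
  obtains C where "ball_lub Y dH D C (Inf (snd ` D))"
    "\<And>b. b \<in> B \<Longrightarrow> center_dist b C + ennreal (Inf (snd ` D)) =
      (INF p\<in>D. center_dist b (fst p) + ennreal (snd p))"
proof -
  obtain C where C: "C \<in> closed_hyperspace0 X d"
    "\<And>b. b \<in> B \<Longrightarrow> center_dist b C + ennreal (Inf (snd ` D)) =
      (INF p\<in>D. center_dist b (fst p) + ennreal (snd p))"
    using hyperspace_limit[OF Y_sub D] by metis
  obtain E r where E: "(E, r) \<in> D" using D unfolding directed_ball_iff by fastforce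
  then have EY: "E \<in> Y" using D unfolding directed_ball_iff by blast
  have "C \<noteq> {}" if "E \<noteq> {}"
  proof -
    obtain b where b: "b \<in> B" "center_dist b E < \<infinity>" using nonempty_iff[OF Y_X[OF EY]] \<open>E \<noteq> {}\<close> by blast
    have "center_dist b C \<le> center_dist b C + ennreal (Inf (snd ` D))" by simp
    also have "\<dots> \<le> center_dist b E + ennreal r"
      unfolding C(2)[OF b(1)] using INF_lower[OF E, of "\<lambda>p. center_dist b (fst p) + ennreal (snd p)"]
      by simp
    also have "\<dots> < \<infinity>" using b(2) by (simp add: ennreal_add_eq_top less_top[symmetric])
    finally show ?thesis using nonempty_iff[OF closed_hyperspace0_subset[OF C(1)]] b(1) by blast
  qed
  then have "C \<in> Y" using EY C(1) Y_cases unfolding closed_hyperspace_def by auto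
  then show ?thesis using that hyperspace_lub[OF Y_sub D] C(2) by blast
qed

lemma Yoneda_complete_Y: "Yoneda_complete Y dH"
  unfolding Yoneda_complete_def dcpo_ball_iff[OF qm_Y] using lub_exists by blast

text \<open>Suprema are unique, so the formula for the constructed supremum holds for every
  supremum.\<close>

lemma lub_formula:
  assumes D: "directed_subset (ball_poset Y dH) D" and lub: "ball_lub Y dH D C r"
  shows "r = Inf (snd ` D)"
    and "\<And>b. b \<in> B \<Longrightarrow> center_dist b C + ennreal r = (INF p\<in>D. center_dist b (fst p) + ennreal (snd p))"
proof -
  obtain C' where C': "ball_lub Y dH D C' (Inf (snd ` D))"
    "\<And>b. b \<in> B \<Longrightarrow> center_dist b C' + ennreal (Inf (snd ` D)) =
      (INF p\<in>D. center_dist b (fst p) + ennreal (snd p))"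
    using lub_exists[OF D] by metis
  have "D \<subseteq> Y \<times> {0..}" using D unfolding directed_ball_iff by simp
  from ball_lub_unique[OF qm_Y this lub C'(1)] C'(2)
  show "r = Inf (snd ` D)"
    and "\<And>b. b \<in> B \<Longrightarrow> center_dist b C + ennreal r = (INF p\<in>D. center_dist b (fst p) + ennreal (snd p))"
    by simp_all
qed

section \<open>Finitely generated closed sets as center points\<close>

text \<open>The closure of \<open>C\<close> is down-closed, so it is enough to test the balls
  \<open>(a, t)\<close> with \<open>a\<close> in \<open>F\<close>; for center points that test is a
  bound on \<open>center_dist a C\<close>.\<close>

lemma hausdorff_down:
  assumes F: "F \<subseteq> B" and C: "C \<subseteq> X"
  shows "dH (specialization_down X d F) C = (SUP a\<in>F. center_dist a C)"
proof (rule ennreal_eqI_reals)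
  fix t :: real assume t: "0 \<le> t"
  have FX: "F \<subseteq> X" using F basis_in by blast
  have "(\<forall>x\<in>specialization_down X d F. (x, t) \<in> ball_closure X d C) \<longleftrightarrow>
      (\<forall>a\<in>F. (a, t) \<in> ball_closure X d C)"
  proof (intro iffI ballI)
    fix x assume cl: "\<forall>a\<in>F. (a, t) \<in> ball_closure X d C" and "x \<in> specialization_down X d F"
    then obtain a where a: "x \<in> X" "a \<in> F" "d x a = 0" unfolding specialization_down_def by blast
    have "(a, t) \<in> ball_closure X d C" using cl a by blast
    moreover have "d x a + ennreal t \<le> ennreal t" using a by simp
    ultimately show "(x, t) \<in> ball_closure X d C"
      using closedin_down[OF closedin_ball_closure] a t by metis
  qed (use subset_specialization_down[OF FX] in blast)
  also have "\<dots> \<longleftrightarrow> (\<forall>a\<in>F. center_dist a C \<le> ennreal t)"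
    using center_ball_closure_iff[OF basis_center C t] F by (meson subsetD)
  finally show "dH (specialization_down X d F) C \<le> ennreal t \<longleftrightarrow> (SUP a\<in>F. center_dist a C) \<le> ennreal t"
    unfolding hausdorff_le_iff[OF specialization_down_subset t] SUP_le_iff .
qed

text \<open>By \<open>hausdorff_down\<close>, membership in the open ball is a finite conjunction of
  strict bounds on \<open>center_dist a C + r\<close>. The infimum formula for suprema gives each
  bound at some member of \<open>D\<close>, and directedness gives a member where all hold.\<close>

lemma center_point_down:
  assumes fin: "finite F" and F: "F \<subseteq> B" and FY: "specialization_down X d F \<in> Y"
  shows "center_point Y dH (specialization_down X d F)" (is "center_point _ _ ?F")
  unfolding center_point_iff scott_open_ball_iff
proof (intro conjI allI impI FY)
  fix e :: real assume e: "0 < e"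
  let ?U = "{(C, s). C \<in> Y \<and> 0 \<le> s \<and> dH ?F C + ennreal s < ennreal e}"
  show "?U \<subseteq> Y \<times> {0..}" by auto
  fix C r C' s
  assume "(C, r) \<in> ?U" and C': "C' \<in> Y" "0 \<le> s" "dH C C' + ennreal s \<le> ennreal r"
  then have C: "C \<in> Y" "0 \<le> r" "dH ?F C + ennreal r < ennreal e" by auto
  have "dH ?F C' \<le> dH ?F C + dH C C'"
    using qm_Y FY C C' unfolding quasi_metric_space_def by blast
  then have "dH ?F C' + ennreal s \<le> dH ?F C + (dH C C' + ennreal s)"
    by (metis add.assoc add_right_mono)
  also have "\<dots> \<le> dH ?F C + ennreal r" by (intro add_left_mono C')
  finally show "(C', s) \<in> ?U" using C C' by auto
next
  fix e :: real and D C r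
  let ?U = "{(C, s). C \<in> Y \<and> 0 \<le> s \<and> dH ?F C + ennreal s < ennreal e}"
  assume D: "directed_subset (ball_poset Y dH) D" and lub: "ball_lub Y dH D C r"
    and "(C, r) \<in> ?U"
  then have C: "C \<in> Y" "0 \<le> r" "dH ?F C + ennreal r < ennreal e" by auto
  have DY: "C \<in> Y \<and> 0 \<le> r" if "(C, r) \<in> D" for C r
    using that D unfolding directed_ball_iff by blast
  have ne: "snd ` D \<noteq> {}" and bdd: "bdd_below (snd ` D)"
    using D unfolding directed_ball_iff by (auto intro!: bdd_belowI[of _ 0])
  \<comment> \<open>A member of radius below \<open>e\<close> starts the induction over
    \<open>F\<close>. The bound \<open>s < e\<close> is carried along because for empty
    \<open>F\<close> no bound over \<open>F\<close> provides it.\<close>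
  have "ennreal r < ennreal e" using C(3) by (metis add.commute le_iff_add order_le_less_trans)
  then have "Inf (snd ` D) < e" using lub_formula(1)[OF D lub] C(2) by (simp add: ennreal_less_iff)
  then have "\<exists>r\<in>snd ` D. r < e" by (simp only: cInf_less_iff[OF ne bdd])
  then obtain C0 r0 where 0: "(C0, r0) \<in> D" "r0 < e" by auto
  have less: "\<exists>E s. (E, s) \<in> D \<and> center_dist a E + ennreal s < ennreal e" if a: "a \<in> F" for a
  proof -
    have aB: "a \<in> B" using a F by blast
    have "center_dist a C + ennreal r \<le> dH ?F C + ennreal r"
      unfolding hausdorff_down[OF F Y_X[OF C(1)]] by (intro add_right_mono SUP_upper a)
    also note C(3)
    finally have "(INF p\<in>D. center_dist a (fst p) + ennreal (snd p)) < ennreal e"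
      unfolding lub_formula(2)[OF D lub aB] .
    then show ?thesis unfolding INF_less_iff by (metis prod.collapse)
  qed
  have "\<exists>E s. (E, s) \<in> D \<and> s < e \<and> (\<forall>a\<in>F. center_dist a E + ennreal s < ennreal e)"
    using fin F less
  proof (induction F)
    case empty
    then show ?case using 0 by blast
  next
    case (insert a F)
    then obtain E1 s1 where 1: "(E1, s1) \<in> D" "s1 < e" "\<forall>a\<in>F. center_dist a E1 + ennreal s1 < ennreal e"
      by (metis insert_subset insertCI)
    obtain E2 s2 where 2: "(E2, s2) \<in> D" "center_dist a E2 + ennreal s2 < ennreal e"
      using insert.prems(2)[of a] by blast
    obtain E s where E: "(E, s) \<in> D" "s \<le> s1"
      "\<And>b. b \<in> B \<Longrightarrow> center_dist b E + ennreal s \<le> center_dist b E1 + ennreal s1"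
      "\<And>b. b \<in> B \<Longrightarrow> center_dist b E + ennreal s \<le> center_dist b E2 + ennreal s2"
      using directed_hyperspace_join[OF Y_sub D 1(1) 2(1)] by metis
    have "center_dist b E + ennreal s < ennreal e" if "b \<in> insert a F" for b
    proof (cases "b = a")
      case True
      then show ?thesis using E(4) 2(2) insert.prems(1) by (meson insert_subset order_le_less_trans)
    next
      case False
      then show ?thesis using E(3) 1(3) insert.prems(1) that
        by (meson insertE insert_subset order_le_less_trans subsetD)
    qed
    then show ?case using E(1,2) 1(2) by (meson order_le_less_trans)
  qed
  then obtain E s where E: "(E, s) \<in> D" "s < e" "\<forall>a\<in>F. center_dist a E + ennreal s < ennreal e"
    by blast
  have EY: "E \<in> Y" "0 \<le> s" using DY[OF E(1)] by auto
  have "0 < ennreal (e - s)" using E(2) by simp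
  moreover have "\<forall>a\<in>F. center_dist a E < ennreal (e - s)"
    using E(3) by (simp only: ennreal_less_diff_iff[OF EY(2)])
  ultimately have "dH ?F E < ennreal (e - s)"
    unfolding hausdorff_down[OF F Y_X[OF EY(1)]] by (subst finite_SUP_less_iff[OF fin])
  then have "(E, s) \<in> ?U" using EY ennreal_less_diff_iff[OF EY(2)] by auto
  with E(1) show "D \<inter> ?U \<noteq> {}" by blast
qed

section \<open>The strong basis of finitely generated closed sets\<close>

lemma strong_basis_Y:
  "strong_basis Y dH {C \<in> Y. \<exists>F. finite F \<and> F \<subseteq> B \<and> C = specialization_down X d F}"
  (is "strong_basis _ _ ?\<A>")
  unfolding strong_basis_def
proof (intro conjI ballI)
  fix A assume "A \<in> ?\<A>"
  then show "center_point Y dH A" using center_point_down by auto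
next
  fix C assume C: "C \<in> Y"
  have CX: "C \<subseteq> X" by (rule Y_X[OF C])
  define D where "D = {(specialization_down X d F, r) |F r. finite F \<and> F \<subseteq> B \<and>
    specialization_down X d F \<in> Y \<and> 0 < r \<and> (\<forall>b\<in>F. center_dist b C < ennreal r)}"
  \<comment> \<open>Each \<open>b\<close> in \<open>F\<close> is replaced by a basis point closer to
    \<open>C\<close>, obtained by interpolating between \<open>b\<close> and a nearby point of
    \<open>C\<close>. Keeping \<open>G\<close> non-empty keeps its down-closure in \<open>Y\<close>
    when \<open>Y\<close> excludes the empty set.\<close>
  have refine: "\<exists>G. finite G \<and> G \<subseteq> B \<and> (F \<noteq> {} \<longrightarrow> G \<noteq> {}) \<and> (\<forall>b\<in>G. center_dist b C < ennreal e) \<and>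
      (\<forall>b\<in>F. \<exists>c\<in>G. d b c \<le> ennreal (r - e))"
    if F: "finite F" "F \<subseteq> B" and e: "0 < e" "\<forall>b\<in>F. center_dist b C < ennreal (r - e)" for F r e
  proof -
    have "\<exists>c\<in>B. center_dist c C < ennreal e \<and> d b c \<le> ennreal (r - e)" if b: "b \<in> F" for b
    proof -
      obtain x where x: "x \<in> C" "d b x < ennreal (r - e)" using center_dist_lessE e(2) b by metis
      have "x \<in> X" "center_point X d b" using x CX F b basis_center by auto
      then obtain c m where c: "c \<in> B" "0 \<le> m" "m < e" "d c x \<le> ennreal m"
        "d b c + ennreal m < ennreal (r - e)"
        using basis_interpolate[OF _ _ x(2) e(1)] by metis
      have "center_dist c C \<le> ennreal m" using center_dist_lower[OF x(1)] c(4) by (rule order_trans)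
      also have "\<dots> < ennreal e" using c by (simp add: ennreal_less_iff)
      finally have "center_dist c C < ennreal e" .
      moreover have "d b c \<le> ennreal (r - e)"
        using c(5) by (meson le_iff_add less_imp_le order_trans)
      ultimately show ?thesis using c(1) by blast
    qed
    then obtain g where g: "\<And>b. b \<in> F \<Longrightarrow> g b \<in> B \<and> center_dist (g b) C < ennreal e \<and> d b (g b) \<le> ennreal (r - e)"
      by metis
    show ?thesis by (rule exI[of _ "g ` F"]) (use g F in auto)
  qed
  \<comment> \<open>Finitely many strict inequalities leave a common slack. Stated with
    \<open>eventually\<close>, it can be combined with the slack for a second finite set.\<close>
  have small: "eventually (\<lambda>e. e < r \<and> (\<forall>b\<in>F. center_dist b C < ennreal (r - e))) (at_right 0)"
    if F: "finite F" "0 < r" "\<forall>b\<in>F. center_dist b C < ennreal r" for F r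
  proof -
    have "eventually (\<lambda>e. center_dist b C < ennreal (r - e)) (at_right 0)" if "b \<in> F" for b
    proof -
      have "((\<lambda>e. ennreal (r - e)) \<longlongrightarrow> ennreal (r - 0)) (at_right 0)"
        by (intro tendsto_ennrealI tendsto_intros)
      then show ?thesis using F(3) that by (intro order_tendstoD) auto
    qed
    then have "eventually (\<lambda>e. \<forall>b\<in>F. center_dist b C < ennreal (r - e)) (at_right 0)"
      by (intro eventually_ball_finite F) auto
    moreover have "eventually (\<lambda>e. e < r) (at_right 0)"
      using F(2) by (intro order_tendstoD(2)[OF tendsto_ident_at])
    ultimately show ?thesis by (rule eventually_elim2) auto
  qed
  have down_Y: "specialization_down X d G \<in> Y"
    if "finite G" "G \<subseteq> B" "specialization_down X d F \<in> Y" "F \<noteq> {} \<longrightarrow> G \<noteq> {}" for F G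
  proof -
    have GX: "G \<subseteq> X" using that basis_in by blast
    then have "specialization_down X d G \<in> closed_hyperspace0 X d"
      using that by (intro closed_hyperspace0_down)
    moreover have "G \<noteq> {}" if "specialization_down X d F \<noteq> {}"
      using that \<open>F \<noteq> {} \<longrightarrow> G \<noteq> {}\<close> unfolding specialization_down_def by blast
    ultimately show ?thesis
      using that(3) Y_cases subset_specialization_down[OF GX] unfolding closed_hyperspace_def by auto
  qed
  have near: "dH (specialization_down X d F) (specialization_down X d G) + ennreal e \<le> ennreal r"
    if "F \<subseteq> B" "0 < e" "e < r" "G \<subseteq> X" "\<forall>b\<in>F. \<exists>c\<in>G. d b c \<le> ennreal (r - e)" for F G e r
  proof -
    have "center_dist b (specialization_down X d G) \<le> ennreal (r - e)" if "b \<in> F" for b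
      using \<open>\<forall>b\<in>F. _\<close> that subset_specialization_down[OF \<open>G \<subseteq> X\<close>]
      by (meson center_dist_lower order_trans subsetD)
    then have "dH (specialization_down X d F) (specialization_down X d G) \<le> ennreal (r - e)"
      unfolding hausdorff_down[OF \<open>F \<subseteq> B\<close> specialization_down_subset] by (rule SUP_least)
    then show ?thesis using that by (simp add: ennreal_add_le_iff)
  qed
  \<comment> \<open>Besides directedness, the free bound \<open>\<delta>\<close> yields members of
    arbitrarily small radius, which later forces the supremum to have radius 0.\<close>
  have D_join: "\<exists>e>0. e < \<delta> \<and> (\<exists>G. (specialization_down X d G, e) \<in> D \<and>
      dH (specialization_down X d F1) (specialization_down X d G) + ennreal e \<le> ennreal r1 \<and>
      dH (specialization_down X d F2) (specialization_down X d G) + ennreal e \<le> ennreal r2)"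
    if "0 < \<delta>"
      and 1: "finite F1" "F1 \<subseteq> B" "specialization_down X d F1 \<in> Y" "0 < r1" "\<forall>b\<in>F1. center_dist b C < ennreal r1"
      and 2: "finite F2" "F2 \<subseteq> B" "specialization_down X d F2 \<in> Y" "0 < r2" "\<forall>b\<in>F2. center_dist b C < ennreal r2"
    for F1 r1 F2 r2 \<delta>
  proof -
    have ev: "eventually (\<lambda>e. e < \<delta> \<and> 0 < e) (at_right 0)"
      using \<open>0 < \<delta>\<close> by (auto simp: eventually_at_right_field)
    have "eventually (\<lambda>e. (e < r1 \<and> (\<forall>b\<in>F1. center_dist b C < ennreal (r1 - e))) \<and>
        (e < r2 \<and> (\<forall>b\<in>F2. center_dist b C < ennreal (r2 - e))) \<and> e < \<delta> \<and> 0 < e) (at_right 0)"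
      by (rule eventually_conj[OF small[OF 1(1,4,5)] eventually_conj[OF small[OF 2(1,4,5)] ev]])
    then obtain e where e: "e < r1" "\<forall>b\<in>F1. center_dist b C < ennreal (r1 - e)"
      "e < r2" "\<forall>b\<in>F2. center_dist b C < ennreal (r2 - e)" "e < \<delta>" "0 < e"
      using eventually_happens'[OF trivial_limit_at_right_real] by blast
    obtain G1 where G1: "finite G1" "G1 \<subseteq> B" "F1 \<noteq> {} \<longrightarrow> G1 \<noteq> {}" "\<forall>b\<in>G1. center_dist b C < ennreal e"
      "\<forall>b\<in>F1. \<exists>c\<in>G1. d b c \<le> ennreal (r1 - e)"
      using refine[OF 1(1,2) e(6,2)] by blast
    obtain G2 where G2: "finite G2" "G2 \<subseteq> B" "F2 \<noteq> {} \<longrightarrow> G2 \<noteq> {}" "\<forall>b\<in>G2. center_dist b C < ennreal e"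
      "\<forall>b\<in>F2. \<exists>c\<in>G2. d b c \<le> ennreal (r2 - e)"
      using refine[OF 2(1,2) e(6,4)] by blast
    let ?G = "G1 \<union> G2"
    have G: "finite ?G" "?G \<subseteq> B" "?G \<subseteq> X" "\<forall>b\<in>?G. center_dist b C < ennreal e"
      using G1 G2 basis_in by auto
    have "specialization_down X d ?G \<in> Y"
      using G1(3) by (intro down_Y[OF G(1,2) 1(3)]) auto
    then have "(specialization_down X d ?G, e) \<in> D"
      unfolding D_def using G e(6) by blast
    moreover have "dH (specialization_down X d F1) (specialization_down X d ?G) + ennreal e \<le> ennreal r1"
      using G1(5) by (intro near[OF 1(2) e(6) e(1) G(3)]) blast
    moreover have "dH (specialization_down X d F2) (specialization_down X d ?G) + ennreal e \<le> ennreal r2"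
      using G2(5) by (intro near[OF 2(2) e(6) e(3) G(3)]) blast
    ultimately show ?thesis using e(5,6) by blast
  qed
  have mem: "\<exists>F. E = specialization_down X d F \<and> finite F \<and> F \<subseteq> B \<and> specialization_down X d F \<in> Y \<and>
      0 < r \<and> (\<forall>b\<in>F. center_dist b C < ennreal r)" if "(E, r) \<in> D" for E r
    using that unfolding D_def by auto
  have single: "(specialization_down X d {b}, r) \<in> D"
    if b: "b \<in> B" and r: "0 < r" "center_dist b C < ennreal r" for b r
  proof -
    have bX: "{b} \<subseteq> X" using b by simp
    have "specialization_down X d {b} \<in> closed_hyperspace0 X d"
      by (rule closed_hyperspace0_down) (use bX in auto)
    then have "specialization_down X d {b} \<in> Y"
      using Y_cases subset_specialization_down[OF bX] unfolding closed_hyperspace_def by auto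
    then show ?thesis unfolding D_def using b r by blast
  qed
  \<comment> \<open>No basis point need be at finite distance from an empty \<open>C\<close>; then
    \<open>C\<close> is itself the down-closure of the empty set and serves as center, with radius
    1.\<close>
  have D_ne: "\<exists>F r. (specialization_down X d F, r) \<in> D"
  proof (cases "C = {}")
    case True
    have "specialization_down X d {} = C" using True by (simp add: specialization_down_def)
    then have "(specialization_down X d {}, 1) \<in> D" unfolding D_def using C by auto
    then show ?thesis by blast
  next
    case False
    then obtain b where b: "b \<in> B" "center_dist b C < \<infinity>" using nonempty_iff[OF CX] by blast
    obtain r where r: "0 < r" "center_dist b C < ennreal r"
      using ennreal_real_between[OF b(2)] by metis
    have "(specialization_down X d {b}, r) \<in> D" by (rule single[OF b(1) r])
    then show ?thesis by blast
  qed
  have dir: "directed_subset (ball_poset Y dH) D"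
    unfolding directed_ball_iff
  proof (intro conjI allI impI)
    show "D \<subseteq> Y \<times> {0..}" unfolding D_def by auto
    show "D \<noteq> {}" using D_ne by blast
    fix E1 r1 E2 r2 assume "(E1, r1) \<in> D" "(E2, r2) \<in> D"
    from mem[OF this(1)] mem[OF this(2)] show "\<exists>E r. (E, r) \<in> D \<and> dH E1 E + ennreal r \<le> ennreal r1 \<and>
        dH E2 E + ennreal r \<le> ennreal r2"
      using D_join[of 1] by (metis zero_less_one)
  qed
  have lub: "ball_lub Y dH D C 0"
    unfolding ball_lub_def
  proof (intro conjI allI ballI impI C)
    fix E r assume "(E, r) \<in> D"
    from mem[OF this] obtain F where F: "E = specialization_down X d F" "F \<subseteq> B"
      "\<forall>b\<in>F. center_dist b C < ennreal r" by blast
    have "dH E C \<le> ennreal r"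
      unfolding F(1) hausdorff_down[OF F(2) CX] using F(3) by (intro SUP_least) auto
    then show "dH E C + ennreal 0 \<le> ennreal r" by simp
  next
    fix C' t assume C': "C' \<in> Y" and t: "0 \<le> t"
      and ub: "\<forall>E r. (E, r) \<in> D \<longrightarrow> dH E C' + ennreal t \<le> ennreal r"
    have t_le: "t \<le> r" if "(E, r) \<in> D" for E r
      using ub that t mem[OF that] ennreal_add_le_iff[of r t] by (meson less_imp_le)
    have "t = 0"
    proof (rule ccontr)
      assume "t \<noteq> 0"
      then have "0 < t" using t by simp
      obtain F r where F: "(specialization_down X d F, r) \<in> D" using D_ne by blast
      from mem[OF F] obtain F' where F': "finite F'" "F' \<subseteq> B" "specialization_down X d F' \<in> Y"
        "0 < r" "\<forall>b\<in>F'. center_dist b C < ennreal r" by metis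
      \<comment> \<open>Joining a member with itself produces one of radius below \<open>t\<close>,
        against \<open>t_le\<close>.\<close>
      obtain e G where "e < t" "(specialization_down X d G, e) \<in> D"
        using D_join[OF \<open>0 < t\<close> F' F'] by blast
      then show False using t_le by fastforce
    qed
    \<comment> \<open>Singletons suffice as tests: for \<open>r\<close> strictly between the two
      distances, \<open>\<down>{b}\<close> with radius \<open>r\<close> belongs to \<open>D\<close>,
      and the upper bound \<open>C'\<close> would be within \<open>r\<close> of
      \<open>b\<close>.\<close>
    have le: "center_dist b C' \<le> center_dist b C + ennreal 0" if b: "b \<in> B" for b
    proof (rule ccontr)
      assume "\<not> center_dist b C' \<le> center_dist b C + ennreal 0"
      then have "center_dist b C < center_dist b C'" by simp
      then obtain r where r: "0 < r" "center_dist b C < ennreal r" "ennreal r < center_dist b C'"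
        by (rule ennreal_real_between)
      have "(specialization_down X d {b}, r) \<in> D" by (rule single[OF b r(1,2)])
      then have "dH (specialization_down X d {b}) C' \<le> ennreal r" using ub \<open>t = 0\<close> by auto
      then have "center_dist b C' \<le> ennreal r"
        using hausdorff_down[of "{b}", OF _ Y_X[OF C']] b by simp
      with r(3) show False by simp
    qed
    have "dH C C' \<le> ennreal 0"
      by (subst hausdorff_le_iff_basis[OF CX Y_X[OF C']]) (use le in auto)
    then show "dH C C' + ennreal t \<le> ennreal 0" using \<open>t = 0\<close> by simp
  qed simp
  have "fst ` D \<subseteq> ?\<A>" unfolding D_def by auto
  moreover have "least (ball_poset Y dH) (C, 0) (Upper (ball_poset Y dH) D)"
    using lub dir unfolding directed_ball_iff by (subst least_ball_iff) auto
  ultimately show "\<exists>D. directed_subset (ball_poset Y dH) D \<and> fst ` D \<subseteq> ?\<A> \<and>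
      least (ball_poset Y dH) (C, 0) (Upper (ball_poset Y dH) D)"
    using dir by blast
qed

end

theorem theorem12p18:
  fixes X :: "'a set" and d :: "'a \<Rightarrow> 'a \<Rightarrow> ennreal" and \<B> :: "'a set"
  assumes "quasi_metric_space X d"
    and "Yoneda_complete X d"
    and "algebraic_qms X d"
    and "strong_basis X d \<B>"
  shows
    "quasi_metric_space (closed_hyperspace0 X d) (hausdorff_quasi_metric X d) \<and>
     Yoneda_complete (closed_hyperspace0 X d) (hausdorff_quasi_metric X d) \<and>
     algebraic_qms (closed_hyperspace0 X d) (hausdorff_quasi_metric X d) \<and>
     (\<forall>C \<in> closed_hyperspace0 X d. \<forall>F.
        finite F \<and> (\<forall>x\<in>F. center_point X d x) \<and> C = specialization_down X d F \<longrightarrow>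
        center_point (closed_hyperspace0 X d) (hausdorff_quasi_metric X d) C) \<and>
     strong_basis (closed_hyperspace0 X d) (hausdorff_quasi_metric X d)
       {C \<in> closed_hyperspace0 X d. \<exists>F.
          finite F \<and> (\<forall>x\<in>F. center_point X d x) \<and> C = specialization_down X d F} \<and>
     strong_basis (closed_hyperspace0 X d) (hausdorff_quasi_metric X d)
       {C \<in> closed_hyperspace0 X d. \<exists>F.
          finite F \<and> F \<subseteq> \<B> \<and> C = specialization_down X d F} \<and>
     quasi_metric_space (closed_hyperspace X d) (hausdorff_quasi_metric X d) \<and>
     Yoneda_complete (closed_hyperspace X d) (hausdorff_quasi_metric X d) \<and>
     algebraic_qms (closed_hyperspace X d) (hausdorff_quasi_metric X d) \<and>
     (\<forall>C \<in> closed_hyperspace X d. \<forall>F.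
        finite F \<and> F \<noteq> {} \<and> (\<forall>x\<in>F. center_point X d x) \<and> C = specialization_down X d F \<longrightarrow>
        center_point (closed_hyperspace X d) (hausdorff_quasi_metric X d) C) \<and>
     strong_basis (closed_hyperspace X d) (hausdorff_quasi_metric X d)
       {C \<in> closed_hyperspace X d. \<exists>F.
          finite F \<and> F \<noteq> {} \<and> (\<forall>x\<in>F. center_point X d x) \<and> C = specialization_down X d F} \<and>
     strong_basis (closed_hyperspace X d) (hausdorff_quasi_metric X d)
       {C \<in> closed_hyperspace X d. \<exists>F.
          finite F \<and> F \<noteq> {} \<and> F \<subseteq> \<B> \<and> C = specialization_down X d F}"
proof -
  let ?K = "{x. center_point X d x}"
  let ?Y = "closed_hyperspace0 X d" and ?Z = "closed_hyperspace X d"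
  \<comment> \<open>All center points together form a strong basis, since they include \<B>. The
    results for generators in a basis, applied to \<open>?K\<close>, then cover arbitrary center
    points.\<close>
  have K: "strong_basis X d ?K"
    using assms(4) unfolding strong_basis_def by (metis mem_Collect_eq subset_iff)
  have hyp: "hyperspace X d A Y" if "strong_basis X d A" "Y = ?Y \<or> Y = ?Z" for A Y
    using assms(1,2) that
    by (simp add: hyperspace_def yoneda_algebraic_def yoneda_qms_def hyperspace_axioms_def
        yoneda_algebraic_axioms_def)
  have B0: "hyperspace X d \<B> ?Y" and B1: "hyperspace X d \<B> ?Z"
    and K0: "hyperspace X d ?K ?Y" and K1: "hyperspace X d ?K ?Z"
    by (simp_all add: hyp assms(4) K)
  \<comment> \<open>Only a non-empty \<open>F\<close> generates a member of \<open>?Z\<close>, so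
    requiring \<open>F \<noteq> {}\<close> leaves the basis supplied by
    \<open>strong_basis_Y\<close> unchanged.\<close>
  have nonempty: "F \<noteq> {}" if "specialization_down X d F \<in> ?Z" for F
    using that unfolding closed_hyperspace_def specialization_down_def by auto
  have sb: "strong_basis Y (hausdorff_quasi_metric X d) \<A>"
    if "hyperspace X d A Y" "\<A> = {C \<in> Y. \<exists>F. finite F \<and> F \<subseteq> A \<and> C = specialization_down X d F}"
    for A Y \<A>
    using hyperspace.strong_basis_Y[OF that(1)] unfolding that(2) .
  have sb0: "strong_basis ?Y (hausdorff_quasi_metric X d)
      {C \<in> ?Y. \<exists>F. finite F \<and> (\<forall>x\<in>F. center_point X d x) \<and> C = specialization_down X d F}"
    by (rule sb[OF K0]) blast
  have sb1: "strong_basis ?Z (hausdorff_quasi_metric X d)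
      {C \<in> ?Z. \<exists>F. finite F \<and> F \<noteq> {} \<and> (\<forall>x\<in>F. center_point X d x) \<and> C = specialization_down X d F}"
    by (rule sb[OF K1]) (use nonempty in blast)
  have sb2: "strong_basis ?Z (hausdorff_quasi_metric X d)
      {C \<in> ?Z. \<exists>F. finite F \<and> F \<noteq> {} \<and> F \<subseteq> \<B> \<and> C = specialization_down X d F}"
    by (rule sb[OF B1]) (use nonempty in blast)
  have center: "center_point Y (hausdorff_quasi_metric X d) C"
    if "hyperspace X d ?K Y" "C \<in> Y" "finite F" "\<forall>x\<in>F. center_point X d x"
      "C = specialization_down X d F" for Y C F
    using hyperspace.center_point_down[OF that(1,3)] that(2,4,5) by blast
  have alg: "algebraic_qms ?Y (hausdorff_quasi_metric X d)"
    "algebraic_qms ?Z (hausdorff_quasi_metric X d)"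
    unfolding algebraic_qms_def using B0[THEN hyperspace.strong_basis_Y] B1[THEN hyperspace.strong_basis_Y]
    by blast+
  have center0: "\<forall>C \<in> ?Y. \<forall>F.
      finite F \<and> (\<forall>x\<in>F. center_point X d x) \<and> C = specialization_down X d F \<longrightarrow>
      center_point ?Y (hausdorff_quasi_metric X d) C"
    using center[OF K0] by blast
  have center1: "\<forall>C \<in> ?Z. \<forall>F.
      finite F \<and> F \<noteq> {} \<and> (\<forall>x\<in>F. center_point X d x) \<and> C = specialization_down X d F \<longrightarrow>
      center_point ?Z (hausdorff_quasi_metric X d) C"
    using center[OF K1] by blast
  show ?thesis
    by (intro conjI alg center0 center1 sb0 sb1 sb2
        B0[THEN hyperspace.qm_Y] B1[THEN hyperspace.qm_Y]
        B0[THEN hyperspace.Yoneda_complete_Y] B1[THEN hyperspace.Yoneda_complete_Y]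
        B0[THEN hyperspace.strong_basis_Y])
qed

end
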